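(* There exist a constant $c>0$ and a positive integer $k_0$ such that for every integer $k\ge k_0$ there is a $k$-permutation $\pi$ with $$L(\pi)\ \ge\ 2^{c\,k^{1/4}}.$$
   Context: Write $[n]=\{1,\dots,n\}$. An $n$-permutation is a permutation of $[n]$. An $n$-permutation $\sigma$ contains a $k$-permutation $\pi$ if there are integers $1\le x_1<x_2<\dots<x_k\le n$ such that for all $1\le i,j\le k$ we have $\sigma(x_i)<\sigma(x_j)$ if and only if $\pi(i)<\pi(j)$; otherwise $\sigma$ avoids $\pi$. $S_n(\pi)$ denotes the number of $n$-permutations that avoid $\pi$. The Stanley-Wilf limit of $\pi$ is $L(\pi)=\lim_{n\to\infty}S_n(\pi)^{1/n}$, which is known to exist and be finite for every permutation $\pi$ (Marcus-Tardos, Arratia). *)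

theory Defs
  imports Complex_Main "HOL-Combinatorics.Permutations"
begin

(* An n-permutation is a function p with "p permutes {1..n}". Such a p is the identity outside
   {1..n} and does not determine n (p also permutes {1..m} for every m > n), so lengths are
   passed explicitly. *)

definition contains_pattern :: "nat \<Rightarrow> (nat \<Rightarrow> nat) \<Rightarrow> nat \<Rightarrow> (nat \<Rightarrow> nat) \<Rightarrow> bool" where
  "contains_pattern n \<sigma> k \<pi> \<longleftrightarrow>
     (\<exists>x :: nat \<Rightarrow> nat. strict_mono_on {1..k} x \<and> x ` {1..k} \<subseteq> {1..n} \<and>
        (\<forall>i\<in>{1..k}. \<forall>j\<in>{1..k}. \<sigma> (x i) < \<sigma> (x j) \<longleftrightarrow> \<pi> i < \<pi> j))"

definition avoiders :: "nat \<Rightarrow> nat \<Rightarrow> (nat \<Rightarrow> nat) \<Rightarrow> (nat \<Rightarrow> nat) set" where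
  "avoiders n k \<pi> = {\<sigma>. \<sigma> permutes {1..n} \<and> \<not> contains_pattern n \<sigma> k \<pi>}"

definition num_avoiders :: "nat \<Rightarrow> nat \<Rightarrow> (nat \<Rightarrow> nat) \<Rightarrow> nat" where
  "num_avoiders n k \<pi> = card (avoiders n k \<pi>)"

(* lim is unspecified for a divergent sequence; by the theorems of Arratia and Marcus-Tardos
   this one converges in the reals for every k-permutation \<pi>. *)
definition stanley_wilf_limit :: "nat \<Rightarrow> (nat \<Rightarrow> nat) \<Rightarrow> real" where
  "stanley_wilf_limit k \<pi> = lim (\<lambda>n. root n (real (num_avoiders n k \<pi>)))"

end

(* Let \<pi> 1 = k. Direct sums make S_n(\<pi>) supermultiplicative, and the Marcus-Tardos theorem
   bounds it exponentially, so by Fekete's lemma L(\<pi>) exists and dominates every root n (S_n(\<pi>)).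

   Following Fox, take for \<pi> a permutation of length about r^2 whose points meet all r * r cells of a
   grid. If a 0/1 matrix of side 2^l contains \<pi>, then there are r disjoint row intervals and r
   disjoint column intervals such that every pair of them spans a nonzero entry. Kill a random set of
   pairs of dyadic intervals, each with probability about 1/l, and keep the entry (p, q) iff no pair of
   dyadic intervals around p and q is killed. The dyadic hulls of disjoint intervals are distinct, so a
   copy of \<pi> would yield r row hulls and r column hulls with no pair killed, which is unlikely once r is a
   large multiple of l^2, while a fraction 2^(-l/4) of the entries survives. Counting partial matchings
   inside such a matrix gives many \<pi>-avoiding permutations, hence L(\<pi>) >= 2^(c l) with l of
   order k^(1/4). *)

theory Submission
  imports Defs "HOL-Library.FuncSet" "HOL-Library.Infinite_Set"
begin

section \<open>Supermultiplicativity\<close>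

text \<open>Fekete's lemma: splitting \<open>n\<close> into \<open>n div m\<close> pieces of length
  \<open>m\<close> and a remainder shows that \<open>u n / n\<close> falls below
  \<open>u m / m\<close> by at most \<open>u m / n\<close>. Hence the limit is the supremum of the
  quotients and dominates each of them.\<close>

lemma superadditive_converges:
  fixes u :: "nat \<Rightarrow> real"
  assumes super: "\<And>m n. u m + u n \<le> u (m + n)"
    and nonneg: "\<And>n. 0 \<le> u n" and bound: "\<And>n. u n \<le> C * real n"
  shows "\<exists>l. (\<lambda>n. u n / real n) \<longlonglongrightarrow> l \<and> (\<forall>m>0. u m / real m \<le> l)"
proof -
  define l where "l = (SUP n\<in>{1..}. u n / real n)"
  have bdd: "bdd_above ((\<lambda>n. u n / real n) ` {1..})"
    by (rule bdd_aboveI2[where M = C]) (auto simp: divide_simps bound)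
  have upper: "u m / real m \<le> l" if "m > 0" for m
    unfolding l_def using that by (intro cSUP_upper bdd) auto
  have mult: "real q * u m \<le> u (q * m)" for q m
  proof (induction q)
    case (Suc q)
    then show ?case using super[of m "q * m"] by (simp add: algebra_simps)
  qed (simp add: nonneg)
  have "(\<lambda>n. u n / real n) \<longlonglongrightarrow> l"
  proof (rule order_tendstoI)
    fix a assume "l < a"
    then show "\<forall>\<^sub>F n in sequentially. u n / real n < a"
      by (intro eventually_sequentiallyI[of 1] le_less_trans[OF upper]) auto
  next
    fix a assume "a < l"
    then obtain m where m: "m \<ge> 1" "a < u m / real m"
      unfolding l_def using less_cSUP_iff[OF _ bdd, of a] by auto
    have "(\<lambda>n. u m / real m - u m / real n) \<longlonglongrightarrow> u m / real m - 0"
      by (intro tendsto_intros lim_const_over_n)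
    then have "\<forall>\<^sub>F n in sequentially. a < u m / real m - u m / real n"
      using m(2) by (intro order_tendstoD(1)) auto
    then show "\<forall>\<^sub>F n in sequentially. a < u n / real n"
      using eventually_gt_at_top[of 0]
    proof eventually_elim
      case (elim n)
      have "real n = real (n div m) * real m + real (n mod m)"
        by (metis div_mult_mod_eq of_nat_add of_nat_mult)
      moreover have "n mod m < m" using m by simp
      ultimately have "real n \<le> (real (n div m) + 1) * real m"
        by (simp add: algebra_simps)
      then have "real n / real m - 1 \<le> real (n div m)"
        using m by (simp add: field_simps)
      then have "(real n / real m - 1) * u m \<le> real (n div m) * u m"
        by (intro mult_right_mono nonneg)
      also have "\<dots> \<le> u (n div m * m)" by (rule mult)
      also have "\<dots> \<le> u n"
        using super[of "n div m * m" "n mod m"] nonneg[of "n mod m"] by simp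
      finally have "(real n / real m - 1) * u m / real n \<le> u n / real n"
        by (rule divide_right_mono) simp
      moreover have "(real n / real m - 1) * u m / real n = u m / real m - u m / real n"
        using elim(2) m by (simp add: field_simps)
      ultimately have "u m / real m - u m / real n \<le> u n / real n" by simp
      with elim(1) show ?case by linarith
    qed
  qed
  with upper show ?thesis by blast
qed

section \<open>Direct sums of avoiders and the limit as a supremum\<close>

definition direct_sum :: "nat \<Rightarrow> (nat \<Rightarrow> nat) \<Rightarrow> (nat \<Rightarrow> nat) \<Rightarrow> nat \<Rightarrow> nat" where
  "direct_sum m \<sigma> \<tau> i = (if i \<le> m then \<sigma> i else m + \<tau> (i - m))"

lemma direct_sum_permutes:
  assumes "\<sigma> permutes {1..m}" "\<tau> permutes {1..n}"
  shows "direct_sum m \<sigma> \<tau> permutes {1..m + n}"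
proof (rule bij_imp_permutes)
  have "bij_betw (\<lambda>i. m + i) {1..n} {m+1..m+n}"
    by (rule bij_betw_byWitness[where f' = "\<lambda>i. i - m"]) auto
  moreover have "bij_betw (\<lambda>i. i - m) {m+1..m+n} {1..n}"
    by (rule bij_betw_byWitness[where f' = "\<lambda>i. m + i"]) auto
  ultimately have "bij_betw ((\<lambda>i. m + i) \<circ> \<tau> \<circ> (\<lambda>i. i - m)) {m+1..m+n} {m+1..m+n}"
    using permutes_imp_bij[OF assms(2)] by (blast intro: bij_betw_trans)
  then have "bij_betw (direct_sum m \<sigma> \<tau>) {m+1..m+n} {m+1..m+n}"
    by (subst bij_betw_cong) (auto simp: direct_sum_def)
  moreover have "bij_betw (direct_sum m \<sigma> \<tau>) {1..m} {1..m}"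
    using permutes_imp_bij[OF assms(1)] by (subst bij_betw_cong) (auto simp: direct_sum_def)
  ultimately have "bij_betw (direct_sum m \<sigma> \<tau>) ({1..m} \<union> {m+1..m+n}) ({1..m} \<union> {m+1..m+n})"
    by (intro bij_betw_combine) auto
  moreover have "{1..m} \<union> {m+1..m+n} = {1..m+n}" by auto
  ultimately show "bij_betw (direct_sum m \<sigma> \<tau>) {1..m+n} {1..m+n}" by simp
  show "direct_sum m \<sigma> \<tau> i = i" if i: "i \<notin> {1..m+n}" for i
  proof (cases "i \<le> m")
    case True
    then show ?thesis using i permutes_not_in[OF assms(1), of i] by (simp add: direct_sum_def)
  next
    case False
    then have "i - m \<notin> {1..n}" using i by auto
    then show ?thesis using False permutes_not_in[OF assms(2)] by (simp add: direct_sum_def)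
  qed
qed

text \<open>Since \<open>\<pi> 1 = k\<close>, the first point of a copy is its highest. If it lies
  in the lower block, no later point can lie in the upper block; if it lies in the upper block, all
  later points follow it there. Either way the copy stays inside one summand.\<close>

lemma direct_sum_avoids:
  assumes \<sigma>: "\<sigma> \<in> avoiders m k \<pi>" and \<tau>: "\<tau> \<in> avoiders n k \<pi>"
    and \<pi>: "\<pi> permutes {1..k}" "\<pi> 1 = k" "k > 0"
  shows "direct_sum m \<sigma> \<tau> \<in> avoiders (m + n) k \<pi>"
proof -
  have perm: "\<sigma> permutes {1..m}" "\<tau> permutes {1..n}"
    using \<sigma> \<tau> by (auto simp: avoiders_def)
  have "\<not> contains_pattern (m + n) (direct_sum m \<sigma> \<tau>) k \<pi>"
  proof
    assume "contains_pattern (m + n) (direct_sum m \<sigma> \<tau>) k \<pi>"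
    then obtain x where x: "strict_mono_on {1..k} x" "x ` {1..k} \<subseteq> {1..m + n}"
      and "\<forall>i\<in>{1..k}. \<forall>j\<in>{1..k}.
        direct_sum m \<sigma> \<tau> (x i) < direct_sum m \<sigma> \<tau> (x j) \<longleftrightarrow> \<pi> i < \<pi> j"
      unfolding contains_pattern_def by (elim exE conjE) (rule that)
    then have iff: "direct_sum m \<sigma> \<tau> (x i) < direct_sum m \<sigma> \<tau> (x j) \<longleftrightarrow> \<pi> i < \<pi> j"
      if "i \<in> {1..k}" "j \<in> {1..k}" for i j
      using that by blast
    have one: "1 \<in> {1..k}" using \<pi>(3) by simp
    have in_range: "x i \<in> {1..m + n}" if "i \<in> {1..k}" for i
      using x(2) that by blast
    show False
    proof (cases "x 1 \<le> m")
      case True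
      have *: "x i \<le> m" if i: "i \<in> {1..k}" for i
      proof (rule ccontr)
        assume "\<not> x i \<le> m"
        have "\<sigma> (x 1) \<in> {1..m}"
          using in_range[OF one] True permutes_in_image[OF perm(1), of "x 1"] by simp
        then have "direct_sum m \<sigma> \<tau> (x 1) \<le> m" using True by (simp add: direct_sum_def)
        moreover have "\<tau> (x i - m) \<in> {1..n}"
          using in_range[OF i] \<open>\<not> x i \<le> m\<close> unfolding permutes_in_image[OF perm(2)] by auto
        then have "m < direct_sum m \<sigma> \<tau> (x i)"
          using \<open>\<not> x i \<le> m\<close> by (simp add: direct_sum_def)
        ultimately have "\<pi> 1 < \<pi> i" using iff[OF one i] by linarith
        moreover have "\<pi> i \<le> k" using permutes_in_image[OF \<pi>(1), of i] i by simp
        ultimately show False using \<pi>(2) by simp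
      qed
      have "x ` {1..k} \<subseteq> {1..m}" using x(2) * by auto
      moreover have "\<sigma> (x i) < \<sigma> (x j) \<longleftrightarrow> \<pi> i < \<pi> j"
        if "i \<in> {1..k}" "j \<in> {1..k}" for i j
        using iff[OF that] *[OF that(1)] *[OF that(2)] by (simp add: direct_sum_def)
      ultimately have "contains_pattern m \<sigma> k \<pi>"
        unfolding contains_pattern_def using x(1) by (intro exI[of _ x] conjI ballI)
      with \<sigma> show False by (simp add: avoiders_def)
    next
      case False
      have *: "m < x i" if i: "i \<in> {1..k}" for i
        using False strict_mono_on_leD[OF x(1) one i] i by simp
      have "strict_mono_on {1..k} (\<lambda>i. x i - m)"
        using strict_mono_onD[OF x(1)] * by (intro strict_mono_onI diff_less_mono less_imp_le) simp_all
      moreover have "(\<lambda>i. x i - m) ` {1..k} \<subseteq> {1..n}"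
      proof (rule image_subsetI)
        fix i assume "i \<in> {1..k}"
        then show "x i - m \<in> {1..n}" using in_range[of i] *[of i] by auto
      qed
      moreover have "\<tau> (x i - m) < \<tau> (x j - m) \<longleftrightarrow> \<pi> i < \<pi> j"
        if "i \<in> {1..k}" "j \<in> {1..k}" for i j
        using iff[OF that] *[OF that(1)] *[OF that(2)] by (simp add: direct_sum_def)
      ultimately have "contains_pattern n \<tau> k \<pi>"
        unfolding contains_pattern_def by (intro exI[of _ "\<lambda>i. x i - m"] conjI ballI)
      with \<tau> show False by (simp add: avoiders_def)
    qed
  qed
  with direct_sum_permutes[OF perm] show ?thesis by (simp add: avoiders_def)
qed

lemma finite_avoiders: "finite (avoiders n k \<pi>)"
  by (rule finite_subset[OF _ finite_permutations[of "{1..n}"]]) (auto simp: avoiders_def)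

lemma num_avoiders_supermult:
  assumes "\<pi> permutes {1..k}" "\<pi> 1 = k" "k > 0"
  shows "num_avoiders m k \<pi> * num_avoiders n k \<pi> \<le> num_avoiders (m + n) k \<pi>"
proof -
  let ?f = "\<lambda>(\<sigma>, \<tau>). direct_sum m \<sigma> \<tau>"
  have "inj_on ?f (avoiders m k \<pi> \<times> avoiders n k \<pi>)"
  proof (rule inj_onI, clarsimp)
    fix \<sigma> \<tau> \<sigma>' \<tau>'
    assume in_av: "\<sigma> \<in> avoiders m k \<pi>" "\<tau> \<in> avoiders n k \<pi>"
        "\<sigma>' \<in> avoiders m k \<pi>" "\<tau>' \<in> avoiders n k \<pi>"
      and eq: "direct_sum m \<sigma> \<tau> = direct_sum m \<sigma>' \<tau>'"
    have perm: "\<sigma> permutes {1..m}" "\<tau> permutes {1..n}" "\<sigma>' permutes {1..m}" "\<tau>' permutes {1..n}"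
      using in_av by (auto simp: avoiders_def)
    have "\<sigma> i = \<sigma>' i" for i
      using fun_cong[OF eq, of i] permutes_not_in[OF perm(1)] permutes_not_in[OF perm(3)]
      by (cases "i \<le> m") (simp_all add: direct_sum_def)
    moreover have "\<tau> i = \<tau>' i" for i
      using fun_cong[OF eq, of "m + i"] permutes_not_in[OF perm(2)] permutes_not_in[OF perm(4)]
      by (cases "i = 0") (simp_all add: direct_sum_def)
    ultimately show "\<sigma> = \<sigma>' \<and> \<tau> = \<tau>'" by blast
  qed
  moreover have "?f ` (avoiders m k \<pi> \<times> avoiders n k \<pi>) \<subseteq> avoiders (m + n) k \<pi>"
    using direct_sum_avoids[OF _ _ assms] by auto
  ultimately have "card (avoiders m k \<pi> \<times> avoiders n k \<pi>) \<le> card (avoiders (m + n) k \<pi>)"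
    by (rule card_inj_on_le[OF _ _ finite_avoiders])
  then show ?thesis by (simp add: num_avoiders_def card_cartesian_product)
qed

text \<open>The identity avoids \<pi>, which starts with its maximum and has a second point, so is
  not increasing. Positivity makes the logarithms of the counts nonnegative.\<close>

lemma num_avoiders_pos:
  assumes "\<pi> permutes {1..k}" "\<pi> 1 = k" "k > 1"
  shows "num_avoiders n k \<pi> > 0"
proof -
  have "\<not> contains_pattern n id k \<pi>"
  proof
    assume "contains_pattern n id k \<pi>"
    then obtain x where x: "strict_mono_on {1..k} x" and "x ` {1..k} \<subseteq> {1..n}"
      and iff: "\<forall>i\<in>{1..k}. \<forall>j\<in>{1..k}. x i < x j \<longleftrightarrow> \<pi> i < \<pi> j"
      unfolding contains_pattern_def id_apply by (elim exE conjE) (rule that)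
    have "\<pi> 1 < \<pi> k" using iff assms(3) strict_mono_onD[OF x, of 1 k] by simp
    moreover have "\<pi> k \<le> k" using permutes_in_image[OF assms(1), of k] assms(3) by simp
    ultimately show False using assms(2) by simp
  qed
  then have "id \<in> avoiders n k \<pi>" by (simp add: avoiders_def permutes_id)
  then show ?thesis
    unfolding num_avoiders_def using finite_avoiders card_gt_0_iff by blast
qed

text \<open>Reduces a lower bound on the limit to a count at a single length \<open>m\<close>.
  Logarithms turn supermultiplicativity into superadditivity, the bound by \<open>K ^ n\<close>
  becomes linear, and convergence of the roots makes \<open>lim\<close> a genuine limit.\<close>

lemma stanley_wilf_limit_ge:
  assumes \<pi>: "\<pi> permutes {1..k}" "\<pi> 1 = k" "k > 1"
    and bound: "\<And>n. real (num_avoiders n k \<pi>) \<le> K ^ n"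
    and m: "m > 0" "B > 0" "B ^ m \<le> real (num_avoiders m k \<pi>)"
  shows "B \<le> stanley_wilf_limit k \<pi>"
proof -
  let ?S = "\<lambda>n. real (num_avoiders n k \<pi>)"
  have pos: "?S n \<ge> 1" for n
    using num_avoiders_pos[OF \<pi>, of n] by linarith
  have "1 \<le> K" using order_trans[OF pos bound, of 1] by simp
  have super: "ln (?S m) + ln (?S n) \<le> ln (?S (m + n))" for m n
  proof -
    have "?S m * ?S n \<le> ?S (m + n)"
      using num_avoiders_supermult[OF \<pi>(1,2), of m n] \<pi>(3) by (simp flip: of_nat_mult)
    then have "ln (?S m * ?S n) \<le> ln (?S (m + n))"
      using pos[of m] pos[of n] by (intro ln_mono mult_pos_pos) linarith+
    then show ?thesis using pos[of m] pos[of n] by (subst (asm) ln_mult_pos) linarith+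
  qed
  have linear: "ln (?S n) \<le> ln K * real n" for n
  proof -
    have "ln (?S n) \<le> ln (K ^ n)"
      using pos[of n] by (intro ln_mono bound) linarith
    then show ?thesis using \<open>1 \<le> K\<close> by (simp add: ln_realpow mult.commute)
  qed
  obtain l where l: "(\<lambda>n. ln (?S n) / real n) \<longlonglongrightarrow> l" "\<And>m. m > 0 \<Longrightarrow> ln (?S m) / real m \<le> l"
    using superadditive_converges[of "\<lambda>n. ln (?S n)", OF super ln_ge_zero[OF pos] linear] by blast
  have eq: "exp (ln (?S n) / real n) = root n (?S n)" if "n > 0" for n
  proof -
    have "root n (?S n) = ?S n powr (1 / real n)"
      using pos[of n] that by (simp add: root_powr_inverse)
    then show ?thesis using pos[of n] by (simp add: powr_def)
  qed
  have "(\<lambda>n. exp (ln (?S n) / real n)) \<longlonglongrightarrow> exp l"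
    by (intro tendsto_exp l)
  then have "(\<lambda>n. root n (?S n)) \<longlonglongrightarrow> exp l"
    by (rule Lim_transform_eventually) (rule eventually_sequentiallyI[of 1], simp add: eq)
  then have "stanley_wilf_limit k \<pi> = exp l"
    unfolding stanley_wilf_limit_def by (rule limI)
  moreover have "B \<le> root m (?S m)"
    using real_root_le_mono[OF m(1,3)] real_root_power_cancel[of m B] m by simp
  moreover have "root m (?S m) \<le> exp l"
    using l(2)[OF m(1)] unfolding eq[OF m(1), symmetric] by simp
  ultimately show ?thesis by linarith
qed

section \<open>The Marcus-Tardos theorem\<close>

lemma increasing_enumeration:
  fixes S :: "nat set"
  assumes "finite S"
  obtains e where "strict_mono_on {1..card S} e" "bij_betw e {1..card S} S"
proof -
  obtain h where h: "bij_betw h {..<card S} S" "strict_mono_on {..<card S} h"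
    by (rule ex_bij_betw_strict_mono_card[OF assms])
  have "bij_betw (\<lambda>i. i - 1) {1..card S} {..<card S}"
    by (rule bij_betw_byWitness[where f' = Suc]) auto
  then have "bij_betw (h \<circ> (\<lambda>i. i - 1)) {1..card S} S"
    using h(1) by (rule bij_betw_trans)
  moreover have "strict_mono_on {1..card S} (h \<circ> (\<lambda>i. i - 1))"
    using strict_mono_onD[OF h(2)] by (intro strict_mono_onI) auto
  ultimately show thesis using that by blast
qed

lemma increasing_selection:
  fixes S :: "nat set"
  assumes "k \<le> card S"
  obtains e where "strict_mono_on {1..k} e" "e ` {1..k} \<subseteq> S"
proof -
  obtain T where T: "T \<subseteq> S" "card T = k" "finite T"
    by (rule obtain_subset_with_card_n[OF assms])
  obtain e where "strict_mono_on {1..card T} e" "bij_betw e {1..card T} T"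
    by (rule increasing_enumeration[OF T(3)])
  then show thesis using T that by (auto simp: bij_betw_def)
qed

text \<open>Containment of the permutation matrix of \<pi> in the 0/1 matrix with nonzero entries
  \<open>E\<close>: \<open>x\<close> and \<open>y\<close> pick \<open>k\<close> columns and
  \<open>k\<close> rows, and further nonzero entries at their crossings are allowed.\<close>

definition occurs :: "nat \<Rightarrow> (nat \<Rightarrow> nat) \<Rightarrow> (nat \<times> nat) set \<Rightarrow> bool" where
  "occurs k \<pi> E \<longleftrightarrow> (\<exists>x y. strict_mono_on {1..k} x \<and> strict_mono_on {1..k} y \<and>
     (\<forall>i\<in>{1..k}. (x i, y (\<pi> i)) \<in> E))"

text \<open>The points of a copy come listed by position, whereas \<open>occurs\<close> indexes
  second coordinates by rank; the witness is therefore \<open>q \<circ> inv \<pi>\<close>.\<close>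

lemma occursI:
  assumes \<pi>: "\<pi> permutes {1..k}"
    and "\<And>i j. i \<in> {1..k} \<Longrightarrow> j \<in> {1..k} \<Longrightarrow> i < j \<Longrightarrow> x i < x j"
    and less: "\<And>i j. i \<in> {1..k} \<Longrightarrow> j \<in> {1..k} \<Longrightarrow> \<pi> i < \<pi> j \<Longrightarrow> q i < q j"
    and "\<And>i. i \<in> {1..k} \<Longrightarrow> (x i, q i) \<in> E"
  shows "occurs k \<pi> E"
  unfolding occurs_def
proof (intro exI conjI ballI)
  show "strict_mono_on {1..k} x" using assms(2) by (intro strict_mono_onI)
  show "strict_mono_on {1..k} (q \<circ> inv \<pi>)"
  proof (rule strict_mono_onI)
    fix i j assume "i \<in> {1..k}" "j \<in> {1..k}" "i < j"
    then show "(q \<circ> inv \<pi>) i < (q \<circ> inv \<pi>) j"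
      using less[of "inv \<pi> i" "inv \<pi> j"] permutes_in_image[OF permutes_inv[OF \<pi>]]
      by (simp only: permutes_inverses[OF \<pi>] o_apply)
  qed
  show "(x i, (q \<circ> inv \<pi>) (\<pi> i)) \<in> E" if "i \<in> {1..k}" for i
    using assms(4)[OF that] by (simp add: permutes_inverses[OF \<pi>])
qed

lemma occurs_converse:
  assumes \<pi>: "\<pi> permutes {1..k}" and "occurs k \<pi> E"
  shows "occurs k (inv \<pi>) (E\<inverse>)"
proof -
  obtain x y where xy: "strict_mono_on {1..k} x" "strict_mono_on {1..k} y"
    and E: "\<And>i. i \<in> {1..k} \<Longrightarrow> (x i, y (\<pi> i)) \<in> E"
    using assms(2) unfolding occurs_def by blast
  have "(y j, x (inv \<pi> j)) \<in> E\<inverse>" if "j \<in> {1..k}" for j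
    using E[of "inv \<pi> j"] that permutes_in_image[OF permutes_inv[OF \<pi>]]
    by (simp add: permutes_inverses[OF \<pi>])
  with xy show ?thesis unfolding occurs_def by blast
qed

section \<open>Block contraction and the extremal recursion\<close>

definition contract :: "nat \<Rightarrow> (nat \<times> nat) set \<Rightarrow> (nat \<times> nat) set" where
  "contract b E = (\<lambda>(p, q). (p div b, q div b)) ` E"

lemma div_less_imp_less: "p div b < q div b \<Longrightarrow> p < q" for p q b :: nat
  using div_le_mono[of q p b] by (meson not_le)

text \<open>One entry of \<open>E\<close> is picked from each block of the copy. A strict inequality
  between quotients by \<open>b\<close> forces the same inequality between the coordinates, so these
  entries form a copy in \<open>E\<close>.\<close>

lemma occurs_contract:
  assumes \<pi>: "\<pi> permutes {1..k}" and "occurs k \<pi> (contract b E)"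
  shows "occurs k \<pi> E"
proof -
  obtain x y where x: "strict_mono_on {1..k} x" and y: "strict_mono_on {1..k} y"
    and E: "\<And>i. i \<in> {1..k} \<Longrightarrow> (x i, y (\<pi> i)) \<in> contract b E"
    using assms(2) unfolding occurs_def by blast
  have "\<forall>i\<in>{1..k}. \<exists>e. e \<in> E \<and> fst e div b = x i \<and> snd e div b = y (\<pi> i)"
  proof
    fix i assume "i \<in> {1..k}"
    from E[OF this] obtain e where "e \<in> E" "(x i, y (\<pi> i)) = (fst e div b, snd e div b)"
      unfolding contract_def case_prod_beta by (rule imageE)
    then show "\<exists>e. e \<in> E \<and> fst e div b = x i \<and> snd e div b = y (\<pi> i)"
      by (intro exI[of _ e]) simp
  qed
  from bchoice[OF this] obtain e where
    e: "\<forall>i\<in>{1..k}. e i \<in> E \<and> fst (e i) div b = x i \<and> snd (e i) div b = y (\<pi> i)" ..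
  show ?thesis
  proof (rule occursI[OF \<pi>])
    fix i j assume ij: "i \<in> {1..k}" "j \<in> {1..k}"
    note e_ij = e[rule_format, OF ij(1)] e[rule_format, OF ij(2)]
    show "fst (e i) < fst (e j)" if "i < j"
      using strict_mono_onD[OF x ij that] e_ij by - (rule div_less_imp_less[of _ b], simp)
    have "\<pi> i \<in> {1..k}" "\<pi> j \<in> {1..k}" using ij by (simp_all only: permutes_in_image[OF \<pi>])
    then show "snd (e i) < snd (e j)" if "\<pi> i < \<pi> j"
      using strict_mono_onD[OF y _ _ that] e_ij by - (rule div_less_imp_less[of _ b], simp)
  qed (use e in simp)
qed

text \<open>Recording which columns of a block are nonempty, and not only how many, permits a
  pigeonhole over sets of columns. A block with at least \<open>k\<close> nonempty columns is called
  wide, one with at least \<open>k\<close> nonempty rows tall.\<close>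

definition block_columns :: "nat \<Rightarrow> (nat \<times> nat) set \<Rightarrow> nat \<Rightarrow> nat \<Rightarrow> nat set" where
  "block_columns b E u v = {p. \<exists>q. (p, q) \<in> E \<and> p div b = u \<and> q div b = v}"

lemma div_eq_subset_interval: "b > 0 \<Longrightarrow> p div b = u \<Longrightarrow> p \<in> {u * b..<u * b + b}" for b p u :: nat
  using dividend_less_div_times[of b p] div_times_less_eq_dividend[of p b] by (auto simp: add.commute)

lemma block_columns_subset: "b > 0 \<Longrightarrow> block_columns b E u v \<subseteq> {u * b..<u * b + b}"
  unfolding block_columns_def by (rule subsetI) (elim CollectE exE conjE, rule div_eq_subset_interval)

text \<open>Marcus and Tardos: among \<open>k\<close> blocks of one block column with the same \<open>k\<close> nonempty
  columns, the \<open>\<pi> i\<close>-th block supplies a point in the \<open>i\<close>-th of these columns.\<close>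

lemma card_wide_blocks:
  assumes \<pi>: "\<pi> permutes {1..k}" and "\<not> occurs k \<pi> E" and "b > 0"
    and V: "finite V" "\<And>v. v \<in> V \<Longrightarrow> k \<le> card (block_columns b E u v)"
  shows "card V \<le> k * 2 ^ b"
proof (rule ccontr)
  assume large: "\<not> card V \<le> k * 2 ^ b"
  let ?P = "Pow {u * b..<u * b + b}"
  \<comment> \<open>Only \<open>2 ^ b\<close> column sets are possible inside block column
    \<open>u\<close>, so more than \<open>k * 2 ^ b\<close> wide blocks force more than
    \<open>k\<close> of them to share one set \<open>S\<close>.\<close>
  obtain S where "S \<in> ?P" and S: "card V \<le> card (block_columns b E u -` {S} \<inter> V) * card ?P"
    using pigeonhole_card[of "block_columns b E u" V ?P] block_columns_subset[OF \<open>b > 0\<close>] V(1)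
    by auto
  define T where "T = block_columns b E u -` {S} \<inter> V"
  have "k * 2 ^ b < card V" using large by simp
  also have "\<dots> \<le> card T * 2 ^ b" using S unfolding T_def by (simp add: card_Pow)
  finally have "k < card T" by simp
  then obtain v where "v \<in> T" by (metis all_not_in_conv card.empty not_less_zero)
  then have "k \<le> card S" unfolding T_def using V(2) by auto
  obtain x where x: "strict_mono_on {1..k} x" "x ` {1..k} \<subseteq> S"
    by (rule increasing_selection[OF \<open>k \<le> card S\<close>])
  obtain w where w: "strict_mono_on {1..k} w" "w ` {1..k} \<subseteq> T"
    by (rule increasing_selection[OF less_imp_le[OF \<open>k < card T\<close>]])
  have "\<exists>q. (x i, q) \<in> E \<and> q div b = w (\<pi> i)" if "i \<in> {1..k}" for i
  proof -
    have "w (\<pi> i) \<in> T" using w(2) permutes_in_image[OF \<pi>, of i] that by blast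
    then have "S = block_columns b E u (w (\<pi> i))" unfolding T_def by blast
    moreover have "x i \<in> S" using x(2) that by blast
    ultimately show ?thesis unfolding block_columns_def by blast
  qed
  then have "\<forall>i\<in>{1..k}. \<exists>q. (x i, q) \<in> E \<and> q div b = w (\<pi> i)" by (rule ballI)
  from bchoice[OF this] obtain q where q: "\<forall>i\<in>{1..k}. (x i, q i) \<in> E \<and> q i div b = w (\<pi> i)" ..
  have "occurs k \<pi> E"
  proof (rule occursI[OF \<pi>])
    fix i j assume ij: "i \<in> {1..k}" "j \<in> {1..k}"
    show "x i < x j" if "i < j" by (rule strict_mono_onD[OF x(1) ij that])
    have "\<pi> i \<in> {1..k}" "\<pi> j \<in> {1..k}" using ij by (simp_all only: permutes_in_image[OF \<pi>])
    then show "q i < q j" if "\<pi> i < \<pi> j"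
      using strict_mono_onD[OF w(1) _ _ that] q[rule_format, OF ij(1)] q[rule_format, OF ij(2)]
      by - (rule div_less_imp_less[of _ b], simp)
  qed (use q in simp)
  with assms(2) show False by blast
qed

definition box :: "nat \<Rightarrow> (nat \<times> nat) set" where
  "box n = {..<n} \<times> {..<n}"

lemma finite_subset_box: "E \<subseteq> box n \<Longrightarrow> finite E"
  unfolding box_def by (rule finite_subset) auto

lemma contract_subset_box: "E \<subseteq> box (b * n) \<Longrightarrow> contract b E \<subseteq> box n"
  by (auto simp: contract_def box_def less_mult_imp_div_less mult.commute)

definition block :: "nat \<Rightarrow> nat \<times> nat \<Rightarrow> (nat \<times> nat) set" where
  "block b e = {fst e * b..<fst e * b + b} \<times> {snd e * b..<snd e * b + b}"

lemma card_block: "card (block b e) = b ^ 2" and finite_block: "finite (block b e)"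
  by (simp_all add: block_def card_cartesian_product power2_eq_square)

lemma in_block: "b > 0 \<Longrightarrow> (p, q) \<in> block b (p div b, q div b)"
  using div_eq_subset_interval unfolding block_def by force

lemma subset_contract_blocks:
  assumes "b > 0" shows "E \<subseteq> (\<Union>e\<in>contract b E. block b e)"
proof (rule subsetI)
  fix z assume "z \<in> E"
  moreover obtain p q where "z = (p, q)" by fastforce
  ultimately show "z \<in> (\<Union>e\<in>contract b E. block b e)"
    using in_block[OF assms, of p q] unfolding contract_def by force
qed

lemma card_all_wide_blocks:
  assumes "\<pi> permutes {1..k}" "\<not> occurs k \<pi> E" "b > 0"
  shows "card {e \<in> box n. k \<le> card (block_columns b E (fst e) (snd e))} \<le> n * (k * 2 ^ b)"
proof -
  let ?V = "\<lambda>u. {v \<in> {..<n}. k \<le> card (block_columns b E u v)}"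
  have "{e \<in> box n. k \<le> card (block_columns b E (fst e) (snd e))} = Sigma {..<n} ?V"
    by (auto simp: box_def)
  then have "card {e \<in> box n. k \<le> card (block_columns b E (fst e) (snd e))} = (\<Sum>u<n. card (?V u))"
    by (simp add: card_SigmaI)
  also have "\<dots> \<le> (\<Sum>u<n. k * 2 ^ b)"
    using assms by (intro sum_mono card_wide_blocks) auto
  finally show ?thesis by simp
qed

text \<open>A nonempty block that is neither wide nor tall has at most \<open>(k - 1) ^ 2\<close>
  entries. There are at most \<open>n * (k * 2 ^ b)\<close> wide blocks and as many tall ones, each
  with at most \<open>b ^ 2\<close> entries; tall blocks are the wide blocks of the transpose, which
  avoids \<open>inv \<pi>\<close>.\<close>

lemma card_le_contract:
  assumes \<pi>: "\<pi> permutes {1..k}" and avoid: "\<not> occurs k \<pi> E" and "b > 0" and E: "E \<subseteq> box (b * n)"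
  shows "card E \<le> (k - 1) ^ 2 * card (contract b E) + 2 * b ^ 2 * (n * (k * 2 ^ b))"
proof -
  let ?W = "{e \<in> box n. k \<le> card (block_columns b E (fst e) (snd e))}"
  let ?T = "{e \<in> box n. k \<le> card (block_columns b (E\<inverse>) (snd e) (fst e))}"
  have fin: "finite (box n)" by (simp add: box_def)
  have "\<not> occurs k (inv \<pi>) (E\<inverse>)"
    using occurs_converse[OF permutes_inv[OF \<pi>], of "E\<inverse>"] avoid by (auto simp: permutes_inv_inv[OF \<pi>])
  then have "card {e \<in> box n. k \<le> card (block_columns b (E\<inverse>) (fst e) (snd e))} \<le> n * (k * 2 ^ b)"
    by (intro card_all_wide_blocks[OF permutes_inv[OF \<pi>] _ \<open>b > 0\<close>])
  moreover have "?T = prod.swap ` {e \<in> box n. k \<le> card (block_columns b (E\<inverse>) (fst e) (snd e))}"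
    by (force simp: box_def)
  ultimately have T: "card ?T \<le> n * (k * 2 ^ b)"
    by (simp add: card_image)
  have W: "card ?W \<le> n * (k * 2 ^ b)"
    by (rule card_all_wide_blocks[OF \<pi> avoid \<open>b > 0\<close>])
  have local: "card (E \<inter> block b e) \<le> (k - 1) ^ 2 + (if e \<in> ?W then b ^ 2 else 0) + (if e \<in> ?T then b ^ 2 else 0)"
    if e: "e \<in> contract b E" for e
  proof (cases "e \<in> ?W \<or> e \<in> ?T")
    case True
    have "card (E \<inter> block b e) \<le> b ^ 2"
      using card_mono[OF finite_block, of "E \<inter> block b e" b e] by (simp add: card_block)
    with True show ?thesis by auto
  next
    case False
    let ?X = "block_columns b E (fst e) (snd e)" and ?Y = "block_columns b (E\<inverse>) (snd e) (fst e)"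
    have "e \<in> box n" using e contract_subset_box[OF E] by blast
    then have small: "card ?X \<le> k - 1" "card ?Y \<le> k - 1" using False by auto
    have "E \<inter> block b e \<subseteq> ?X \<times> ?Y"
    proof (rule subrelI)
      fix p q assume pq: "(p, q) \<in> E \<inter> block b e"
      then have "p div b = fst e" "q div b = snd e"
        by (auto simp: block_def mult.commute intro!: div_nat_eqI)
      then show "(p, q) \<in> ?X \<times> ?Y" using pq unfolding block_columns_def by auto
    qed
    moreover have "finite ?X" "finite ?Y"
      by (rule finite_subset[OF block_columns_subset[OF \<open>b > 0\<close>]], simp)+
    ultimately have "card (E \<inter> block b e) \<le> card ?X * card ?Y"
      unfolding card_cartesian_product[symmetric] by (intro card_mono finite_cartesian_product)
    also have "\<dots> \<le> (k - 1) ^ 2"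
      unfolding power2_eq_square by (rule mult_le_mono[OF small])
    finally show ?thesis by simp
  qed
  have finc: "finite (contract b E)" using finite_subset_box[OF contract_subset_box[OF E]] .
  have "E = (\<Union>e\<in>contract b E. E \<inter> block b e)"
    using subset_contract_blocks[OF \<open>b > 0\<close>, of E] by blast
  then have "card E \<le> (\<Sum>e\<in>contract b E. card (E \<inter> block b e))"
    using card_UN_le[OF finc, of "\<lambda>e. E \<inter> block b e"] by simp
  also have "\<dots> \<le> (\<Sum>e\<in>contract b E. (k - 1) ^ 2 + (if e \<in> ?W then b ^ 2 else 0) + (if e \<in> ?T then b ^ 2 else 0))"
    by (intro sum_mono local)
  also have "\<dots> = (k - 1) ^ 2 * card (contract b E) + b ^ 2 * card (contract b E \<inter> ?W) + b ^ 2 * card (contract b E \<inter> ?T)"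
    by (simp only: sum.distrib sum.inter_restrict[OF finc, symmetric] sum_constant) (simp add: mult.commute)
  also have "\<dots> \<le> (k - 1) ^ 2 * card (contract b E) + b ^ 2 * (n * (k * 2 ^ b)) + b ^ 2 * (n * (k * 2 ^ b))"
    using fin by (intro add_mono mult_le_mono le_refl order_trans[OF card_mono W] order_trans[OF card_mono T]) auto
  finally show ?thesis by simp
qed

text \<open>For block side \<open>b = k ^ 2\<close> this is the coefficient
  \<open>2 * b ^ 2 * (k * 2 ^ b)\<close> with which wide and tall blocks enter the
  recursion.\<close>

definition extremal_constant :: "nat \<Rightarrow> nat" where
  "extremal_constant k = 2 * (k ^ 2) ^ 2 * (k * 2 ^ (k ^ 2))"

text \<open>The block side \<open>k ^ 2\<close> is chosen so that
  \<open>(k - 1) ^ 2 + 1 \<le> k ^ 2\<close>: one contraction step then reproduces the same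
  constant. Sides that are powers of \<open>k ^ 2\<close> divide evenly into blocks.\<close>

lemma extremal_bound:
  assumes \<pi>: "\<pi> permutes {1..k}" and "k > 0"
  shows "E \<subseteq> box ((k ^ 2) ^ j) \<Longrightarrow> \<not> occurs k \<pi> E \<Longrightarrow> card E \<le> extremal_constant k * (k ^ 2) ^ j"
proof (induction j arbitrary: E)
  case 0
  then have "card E \<le> card {(0::nat, 0::nat)}" by (intro card_mono) (auto simp: box_def)
  moreover have "1 \<le> extremal_constant k" using \<open>k > 0\<close> by (simp add: extremal_constant_def Suc_le_eq)
  ultimately show ?case by simp
next
  case (Suc j)
  let ?b = "k ^ 2" and ?C = "extremal_constant k"
  have b: "?b > 0" and E: "E \<subseteq> box (?b * ?b ^ j)" using Suc.prems \<open>k > 0\<close> by simp_all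
  have IH: "card (contract ?b E) \<le> ?C * ?b ^ j"
    using Suc.IH[OF contract_subset_box[OF E]] occurs_contract[OF \<pi>] Suc.prems(2) by blast
  have "card E \<le> (k - 1) ^ 2 * card (contract ?b E) + 2 * ?b ^ 2 * (?b ^ j * (k * 2 ^ ?b))"
    by (rule card_le_contract[OF \<pi> Suc.prems(2) b E])
  also have "\<dots> = (k - 1) ^ 2 * card (contract ?b E) + ?C * ?b ^ j"
    by (simp add: extremal_constant_def)
  also have "\<dots> \<le> (k - 1) ^ 2 * (?C * ?b ^ j) + ?C * ?b ^ j"
    using IH by simp
  also have "\<dots> = ((k - 1) ^ 2 + 1) * (?C * ?b ^ j)" by (simp add: algebra_simps)
  also have "\<dots> \<le> ?b * (?C * ?b ^ j)"
  proof (rule mult_right_mono)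
    obtain m where "k = Suc m" using \<open>k > 0\<close> gr0_implies_Suc by blast
    then show "(k - 1) ^ 2 + 1 \<le> ?b" by (simp add: power2_eq_square)
  qed simp
  finally show ?case by (simp add: algebra_simps)
qed

section \<open>Counting avoiding matrices\<close>

definition avoiding_sets :: "nat \<Rightarrow> (nat \<Rightarrow> nat) \<Rightarrow> nat \<Rightarrow> (nat \<times> nat) set set" where
  "avoiding_sets k \<pi> n = {E. E \<subseteq> box n \<and> \<not> occurs k \<pi> E}"

lemma finite_avoiding_sets: "finite (avoiding_sets k \<pi> n)"
  by (rule finite_subset[of _ "Pow (box n)"]) (auto simp: avoiding_sets_def box_def)

text \<open>An avoiding set lies in the blocks marked by its contraction, which avoids \<pi> too and
  has at most \<open>C * b ^ j\<close> entries. So each contraction arises from at most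
  \<open>2 ^ (b ^ 2 * (C * b ^ j))\<close> sets, and as \<open>b \<ge> 2\<close> these exponents sum
  geometrically.\<close>

lemma card_avoiding_sets:
  assumes \<pi>: "\<pi> permutes {1..k}" and "k \<ge> 2"
  shows "card (avoiding_sets k \<pi> ((k ^ 2) ^ j)) \<le> 2 ^ (((k ^ 2) ^ 2 * extremal_constant k + 1) * (k ^ 2) ^ j)"
proof (induction j)
  case 0
  have "card (avoiding_sets k \<pi> 1) \<le> card (Pow {(0::nat, 0::nat)})"
    by (intro card_mono) (auto simp: avoiding_sets_def box_def)
  also have "\<dots> = 2 ^ 1" by (simp add: card_Pow)
  also have "\<dots> \<le> 2 ^ (((k ^ 2) ^ 2 * extremal_constant k + 1) * (k ^ 2) ^ 0)"
    by (intro power_increasing) auto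
  finally show ?case by simp
next
  case (Suc j)
  define b where "b = k ^ 2"
  define C where "C = extremal_constant k"
  have "2 * 2 \<le> k * k" using \<open>k \<ge> 2\<close> by (intro mult_le_mono)
  then have "2 \<le> b" by (simp add: b_def power2_eq_square)
  let ?A = "avoiding_sets k \<pi>"
  let ?G = "\<lambda>E'. \<Union>e\<in>E'. block b e"
  have "?A (b ^ Suc j) \<subseteq> (\<Union>E'\<in>?A (b ^ j). Pow (?G E'))"
  proof
    fix E assume "E \<in> ?A (b ^ Suc j)"
    then have E: "E \<subseteq> box (b * b ^ j)" "\<not> occurs k \<pi> E" by (auto simp: avoiding_sets_def)
    then have "contract b E \<in> ?A (b ^ j)"
      using contract_subset_box[OF E(1)] occurs_contract[OF \<pi>] by (auto simp: avoiding_sets_def)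
    moreover have "E \<in> Pow (?G (contract b E))"
      using subset_contract_blocks[of b E] \<open>2 \<le> b\<close> by simp
    ultimately show "E \<in> (\<Union>E'\<in>?A (b ^ j). Pow (?G E'))" by blast
  qed
  moreover have fin: "finite (?G E')" if "E' \<in> ?A (b ^ j)" for E'
    using that finite_subset_box[of E'] finite_block by (auto simp: avoiding_sets_def)
  ultimately have "card (?A (b ^ Suc j)) \<le> card (\<Union>E'\<in>?A (b ^ j). Pow (?G E'))"
    by (intro card_mono) (auto simp: finite_avoiding_sets)
  also have "\<dots> \<le> (\<Sum>E'\<in>?A (b ^ j). card (Pow (?G E')))"
    by (rule card_UN_le[OF finite_avoiding_sets])
  also have "\<dots> \<le> (\<Sum>E'\<in>?A (b ^ j). 2 ^ (b ^ 2 * (C * b ^ j)))"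
  proof (rule sum_mono)
    fix E' assume E': "E' \<in> ?A (b ^ j)"
    then have "finite E'" using finite_subset_box[of E'] by (auto simp: avoiding_sets_def)
    have "card (?G E') \<le> (\<Sum>e\<in>E'. card (block b e))" by (rule card_UN_le[OF \<open>finite E'\<close>])
    also have "\<dots> = b ^ 2 * card E'" by (simp add: card_block)
    also have "\<dots> \<le> b ^ 2 * (C * b ^ j)"
      using extremal_bound[OF \<pi>, of E' j] E' \<open>k \<ge> 2\<close>
      by (intro mult_left_mono) (auto simp: b_def C_def avoiding_sets_def)
    finally show "card (Pow (?G E')) \<le> 2 ^ (b ^ 2 * (C * b ^ j))"
      using fin[OF E'] by (simp add: card_Pow power_increasing)
  qed
  also have "\<dots> = card (?A (b ^ j)) * 2 ^ (b ^ 2 * (C * b ^ j))" by simp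
  also have "\<dots> \<le> 2 ^ ((b ^ 2 * C + 1) * b ^ j) * 2 ^ (b ^ 2 * (C * b ^ j))"
    using Suc.IH by (intro mult_right_mono) (auto simp: b_def C_def)
  also have "\<dots> = 2 ^ ((b ^ 2 * C + 1) * b ^ j + b ^ 2 * (C * b ^ j))"
    by (simp add: power_add)
  also have "\<dots> \<le> 2 ^ ((b ^ 2 * C + 1) * b ^ Suc j)"
  proof (rule power_increasing)
    have "(b ^ 2 * C + 1) * b ^ j + b ^ 2 * (C * b ^ j) \<le> 2 * ((b ^ 2 * C + 1) * b ^ j)"
      by (simp add: algebra_simps)
    also have "\<dots> \<le> b * ((b ^ 2 * C + 1) * b ^ j)"
      using \<open>2 \<le> b\<close> by (rule mult_right_mono) simp
    finally show "(b ^ 2 * C + 1) * b ^ j + b ^ 2 * (C * b ^ j) \<le> (b ^ 2 * C + 1) * b ^ Suc j"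
      by (simp add: algebra_simps)
  qed simp
  finally show ?case by (simp add: b_def C_def)
qed

section \<open>From matrices back to permutations\<close>

definition graph_on :: "nat \<Rightarrow> (nat \<Rightarrow> nat) \<Rightarrow> (nat \<times> nat) set" where
  "graph_on n \<sigma> = (\<lambda>i. (i, \<sigma> i)) ` {1..n}"

lemma occurs_graph_on:
  assumes \<pi>: "\<pi> permutes {1..k}" and "occurs k \<pi> (graph_on n \<sigma>)"
  shows "contains_pattern n \<sigma> k \<pi>"
proof -
  obtain x y where x: "strict_mono_on {1..k} x" and y: "strict_mono_on {1..k} y"
    and E: "\<And>i. i \<in> {1..k} \<Longrightarrow> (x i, y (\<pi> i)) \<in> graph_on n \<sigma>"
    using assms(2) unfolding occurs_def by blast
  have x_in: "x i \<in> {1..n}" and \<sigma>: "\<sigma> (x i) = y (\<pi> i)" if "i \<in> {1..k}" for i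
    using E[OF that] unfolding graph_on_def by auto
  show ?thesis unfolding contains_pattern_def
  proof (intro exI conjI ballI image_subsetI)
    fix i j assume "i \<in> {1..k}" "j \<in> {1..k}"
    then show "\<sigma> (x i) < \<sigma> (x j) \<longleftrightarrow> \<pi> i < \<pi> j"
      using strict_mono_on_less[OF y] permutes_in_image[OF \<pi>] by (simp only: \<sigma>)
  qed (use x x_in in auto)
qed

text \<open>Graphs inject the avoiders into the avoiding sets of a box whose side is the first power
  of \<open>k ^ 2\<close> above \<open>n\<close>. Rounding the side up costs at most a factor
  \<open>k ^ 2\<close> in the exponent.\<close>

lemma num_avoiders_exponential:
  assumes \<pi>: "\<pi> permutes {1..k}" and "k \<ge> 2"
  shows "\<exists>K. \<forall>n. real (num_avoiders n k \<pi>) \<le> K ^ n"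
proof (intro exI allI)
  define D where "D = (k ^ 2) ^ 2 * extremal_constant k + 1"
  fix n
  show "real (num_avoiders n k \<pi>) \<le> (2 ^ (D * k ^ 2)) ^ n"
  proof (cases "n = 0")
    case True
    have "avoiders 0 k \<pi> \<subseteq> {id}" by (auto simp: avoiders_def)
    then have "num_avoiders 0 k \<pi> \<le> card {id :: nat \<Rightarrow> nat}"
      unfolding num_avoiders_def by (intro card_mono) auto
    then show ?thesis using True by simp
  next
    case False
    have "2 * 2 \<le> k * k" using \<open>k \<ge> 2\<close> by (intro mult_le_mono)
    then have "2 \<le> k ^ 2" by (simp add: power2_eq_square)
    then obtain j where j: "(k ^ 2) ^ j \<le> n" "n < (k ^ 2) ^ (j + 1)"
      using ex_power_ivl1[of "k ^ 2" n] False by auto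
    have "inj_on (graph_on n) (avoiders n k \<pi>)"
    proof (rule inj_onI, rule ext)
      fix \<sigma> \<tau> i
      assume perm: "\<sigma> \<in> avoiders n k \<pi>" "\<tau> \<in> avoiders n k \<pi>" and eq: "graph_on n \<sigma> = graph_on n \<tau>"
      show "\<sigma> i = \<tau> i"
      proof (cases "i \<in> {1..n}")
        case True
        then have "(i, \<sigma> i) \<in> graph_on n \<tau>" using eq unfolding graph_on_def by blast
        then show ?thesis unfolding graph_on_def by auto
      next
        case False
        then show ?thesis
          using perm permutes_not_in[of \<sigma> "{1..n}" i] permutes_not_in[of \<tau> "{1..n}" i]
          by (simp add: avoiders_def)
      qed
    qed
    moreover have "graph_on n ` avoiders n k \<pi> \<subseteq> avoiding_sets k \<pi> ((k ^ 2) ^ (j + 1))"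
    proof (rule image_subsetI)
      fix \<sigma> assume "\<sigma> \<in> avoiders n k \<pi>"
      then have \<sigma>: "\<sigma> permutes {1..n}" "\<not> contains_pattern n \<sigma> k \<pi>" by (auto simp: avoiders_def)
      have "graph_on n \<sigma> \<subseteq> {1..n} \<times> {1..n}"
        unfolding graph_on_def
        by (intro image_subsetI SigmaI) (simp_all only: permutes_in_image[OF \<sigma>(1)])
      \<comment> \<open>The strict inequality \<open>n < (k ^ 2) ^ (j + 1)\<close> matters here:
        coordinates of a graph run from 1 to \<open>n\<close>, those of a box start at 0.\<close>
      also have "\<dots> \<subseteq> box ((k ^ 2) ^ (j + 1))"
        unfolding box_def using j(2) by (intro Sigma_mono subsetI) auto
      finally show "graph_on n \<sigma> \<in> avoiding_sets k \<pi> ((k ^ 2) ^ (j + 1))"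
        unfolding avoiding_sets_def using occurs_graph_on[OF \<pi>] \<sigma>(2) by blast
    qed
    ultimately have "num_avoiders n k \<pi> \<le> card (avoiding_sets k \<pi> ((k ^ 2) ^ (j + 1)))"
      unfolding num_avoiders_def by (rule card_inj_on_le[OF _ _ finite_avoiding_sets])
    also have "\<dots> \<le> 2 ^ (D * (k ^ 2) ^ (j + 1))"
      unfolding D_def by (rule card_avoiding_sets[OF assms])
    also have "\<dots> \<le> 2 ^ (D * k ^ 2 * n)"
      using j(1) by (intro power_increasing) auto
    finally have "real (num_avoiders n k \<pi>) \<le> real (2 ^ (D * k ^ 2 * n))"
      by (simp only: of_nat_le_iff)
    then show ?thesis by (simp add: power_mult)
  qed
qed

section \<open>Dense matrices avoiding a grid permutation\<close>

text \<open>Position \<open>2 + a * r + b\<close> receives value \<open>1 + b * r + a\<close>, a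
  swap of base \<open>r\<close> digits, so that the points meet all \<open>r * r\<close> cells. The
  first position carries the maximum, as supermultiplicativity demands, and the increasing tail pads
  the length to an arbitrary \<open>k\<close>.\<close>

definition grid_perm :: "nat \<Rightarrow> nat \<Rightarrow> nat \<Rightarrow> nat" where
  "grid_perm r k p =
    (if p = 1 then k
     else if p \<in> {2..r * r + 1} then 1 + ((p - 2) mod r * r + (p - 2) div r)
     else if p \<in> {r * r + 2..k} then p - 1 else p)"

lemma two_digit_less: "a < r \<Longrightarrow> b < r \<Longrightarrow> a * r + b < r * r" for a b r :: nat
proof -
  assume "a < r" "b < r"
  then have "a * r + b < Suc a * r" by simp
  also have "\<dots> \<le> r * r" using \<open>a < r\<close> by (intro mult_right_mono) auto
  finally show ?thesis .
qed

lemma two_digit_unique: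
  "b < r \<Longrightarrow> d < r \<Longrightarrow> a * r + b = c * r + d \<Longrightarrow> a = c \<and> b = d" for a b c d r :: nat
  by (metis add.commute add_left_imp_eq bot_nat_0.not_eq_extremum div_less div_mult_self3 less_nat_zero_code add_0)

lemma grid_perm_1: "grid_perm r k 1 = k"
  by (simp add: grid_perm_def)

lemma grid_perm_cell:
  assumes "a < r" "b < r"
  shows "grid_perm r k (2 + a * r + b) = 1 + (b * r + a)"
proof -
  have "a * r + b < r * r" by (rule two_digit_less[OF assms])
  moreover have "(a * r + b) mod r = b" "(a * r + b) div r = a" using assms by auto
  ultimately show ?thesis by (simp add: grid_perm_def)
qed

lemma grid_perm_cases:
  fixes p k r :: nat
  assumes "p \<in> {1..k}"
  obtains (first) "p = 1" | (cell) a b where "a < r" "b < r" "p = 2 + a * r + b"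
    | (rest) "p \<in> {r * r + 2..k}"
proof -
  consider "p = 1" | "p \<in> {2..r * r + 1}" | "p \<in> {r * r + 2..k}"
    using assms by fastforce
  then show thesis
  proof cases
    case 2
    then have "p - 2 < r * r" by auto
    then have "(p - 2) div r < r" by (simp add: less_mult_imp_div_less)
    moreover have "(p - 2) mod r < r" using \<open>p - 2 < r * r\<close> by (cases r) auto
    moreover have "p = 2 + (p - 2) div r * r + (p - 2) mod r" using 2 by (simp, arith)
    ultimately show thesis by (rule cell)
  qed (use first rest in auto)
qed

lemma grid_perm_rest: "p \<in> {r * r + 2..k} \<Longrightarrow> grid_perm r k p = p - 1"
  by (simp add: grid_perm_def)

text \<open>The three groups of positions take values in the disjoint ranges \<open>{k}\<close>,
  \<open>{1..r * r}\<close> and \<open>{r * r + 1..k - 1}\<close>, and the digits of a value in the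
  middle range determine its position. On a finite set injectivity suffices.\<close>

lemma grid_perm_permutes:
  assumes k: "r * r + 1 \<le> k"
  shows "grid_perm r k permutes {1..k}"
proof (rule bij_imp_permutes)
  let ?g = "grid_perm r k"
  have "?g p \<in> {1..k}" if "p \<in> {1..k}" for p
    using that
  proof (cases rule: grid_perm_cases[where r = r])
    case (cell a b)
    then show ?thesis using grid_perm_cell[OF cell(1,2), of k] two_digit_less[OF cell(2,1)] k by simp
  qed (use k grid_perm_1[of r k] grid_perm_rest in auto)
  then have "?g ` {1..k} \<subseteq> {1..k}" by blast
  moreover have "inj_on ?g {1..k}"
  proof (rule inj_onI)
    fix p p' assume "p \<in> {1..k}" "p' \<in> {1..k}" and eq: "?g p = ?g p'"
    from this(1) show "p = p'"
    proof (cases rule: grid_perm_cases[where r = r])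
      case first
      from \<open>p' \<in> {1..k}\<close> show ?thesis
      proof (cases rule: grid_perm_cases[where r = r])
        case (cell a b)
        then show ?thesis
          using first eq grid_perm_1[of r k] grid_perm_cell[OF cell(1,2), of k] two_digit_less[OF cell(2,1)] k by simp
      qed (use first eq grid_perm_1[of r k] grid_perm_rest[of p' r k] in auto)
    next
      case pc: (cell a b)
      note p = grid_perm_cell[OF pc(1,2), of k] two_digit_less[OF pc(2,1)]
      from \<open>p' \<in> {1..k}\<close> show ?thesis
      proof (cases rule: grid_perm_cases[where r = r])
        case (cell c d)
        then have "b * r + a = d * r + c"
          using p(1) pc(3) eq grid_perm_cell[OF cell(1,2), of k] by simp
        then show ?thesis using two_digit_unique[OF pc(1) cell(1)] pc(3) cell(3) by blast
      qed (use pc(3) p k eq grid_perm_1[of r k] grid_perm_rest[of p' r k] in auto)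
    next
      case rest
      from \<open>p' \<in> {1..k}\<close> show ?thesis
      proof (cases rule: grid_perm_cases[where r = r])
        case (cell a b)
        then show ?thesis
          using rest eq grid_perm_rest[OF rest] grid_perm_cell[OF cell(1,2), of k] two_digit_less[OF cell(2,1)] by auto
      qed (use rest eq grid_perm_1[of r k] grid_perm_rest[of p' r k] grid_perm_rest[OF rest] in auto)
    qed
  qed
  ultimately show "bij_betw ?g {1..k} {1..k}"
    by (simp add: bij_betw_def endo_inj_surj)
  show "?g p = p" if "p \<notin> {1..k}" for p
    using that k by (auto simp: grid_perm_def)
qed

section \<open>Grids of intervals inside a copy\<close>

definition separated_intervals :: "nat \<Rightarrow> (nat \<Rightarrow> nat) \<Rightarrow> (nat \<Rightarrow> nat) \<Rightarrow> bool" where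
  "separated_intervals r lo hi \<longleftrightarrow>
     (\<forall>a<r. lo a \<le> hi a) \<and> (\<forall>a<r. \<forall>a'<r. a < a' \<longrightarrow> hi a < lo a')"

text \<open>Cuts the selected coordinates from index \<open>s\<close> on into \<open>r\<close>
  consecutive runs of length \<open>r\<close>. Positions use \<open>s = 2\<close>, values
  \<open>s = 1\<close>, because the cells occupy positions from 2 but values from 1.\<close>

lemma separated_intervals_strict_mono:
  assumes x: "strict_mono_on {1..k} x" and k: "s + r * r \<le> Suc k" and "s > 0"
  shows "separated_intervals r (\<lambda>a. x (s + a * r)) (\<lambda>a. x (s + a * r + (r - 1)))"
proof -
  have in_range: "s + a * r + b \<in> {1..k}" if "a < r" "b < r" for a b
    using two_digit_less[OF that] k \<open>s > 0\<close> by auto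
  have "x (s + a * r) \<le> x (s + a * r + (r - 1))" if "a < r" for a
    using strict_mono_on_leD[OF x in_range[OF that, of 0] in_range[OF that, of "r - 1"]] that by simp
  moreover have "x (s + a * r + (r - 1)) < x (s + a' * r)" if "a < r" "a' < r" "a < a'" for a a'
  proof -
    have "a * r + (r - 1) < Suc a * r" using that by simp
    also have "\<dots> \<le> a' * r" using that by (intro mult_right_mono) auto
    finally have "s + a * r + (r - 1) < s + a' * r" by simp
    then show ?thesis
      using strict_mono_onD[OF x in_range[OF that(1), of "r - 1"] in_range[OF that(2), of 0]] that by simp
  qed
  ultimately show ?thesis unfolding separated_intervals_def by blast
qed

text \<open>The point at position \<open>2 + a * r + b\<close> has value
  \<open>1 + b * r + a\<close>, so it belongs to run \<open>a\<close> of the positions and to run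
  \<open>b\<close> of the values: every pair of runs spans an entry of \<open>E\<close>.\<close>

lemma occurs_grid_perm:
  assumes k: "r * r + 1 \<le> k" and "occurs k (grid_perm r k) E" and "E \<subseteq> box n"
  obtains lo hi lo' hi' where "separated_intervals r lo hi" "separated_intervals r lo' hi'"
    "\<forall>a<r. hi a < n \<and> hi' a < n"
    "\<forall>a<r. \<forall>b<r. \<exists>p q. (p, q) \<in> E \<and> lo a \<le> p \<and> p \<le> hi a \<and> lo' b \<le> q \<and> q \<le> hi' b"
proof -
  obtain x y where x: "strict_mono_on {1..k} x" and y: "strict_mono_on {1..k} y"
    and E: "\<And>i. i \<in> {1..k} \<Longrightarrow> (x i, y (grid_perm r k i)) \<in> E"
    using assms(2) unfolding occurs_def by blast
  show thesis
  proof (rule that)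
    show "separated_intervals r (\<lambda>a. x (2 + a * r)) (\<lambda>a. x (2 + a * r + (r - 1)))"
      by (rule separated_intervals_strict_mono[OF x]) (use k in auto)
    show "separated_intervals r (\<lambda>b. y (1 + b * r)) (\<lambda>b. y (1 + b * r + (r - 1)))"
      by (rule separated_intervals_strict_mono[OF y]) (use k in auto)
    have in_E: "(x (2 + a * r + b), y (1 + b * r + a)) \<in> E" if "a < r" "b < r" for a b
      using E[of "2 + a * r + b"] two_digit_less[OF that] k grid_perm_cell[OF that, of k] by simp
    show "\<forall>a<r. x (2 + a * r + (r - 1)) < n \<and> y (1 + a * r + (r - 1)) < n"
    proof (intro allI impI)
      fix a assume "a < r"
      then show "x (2 + a * r + (r - 1)) < n \<and> y (1 + a * r + (r - 1)) < n"
        using in_E[of a "r - 1"] in_E[of "r - 1" a] \<open>E \<subseteq> box n\<close> unfolding box_def by auto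
    qed
    show "\<forall>a<r. \<forall>b<r. \<exists>p q. (p, q) \<in> E \<and> x (2 + a * r) \<le> p \<and> p \<le> x (2 + a * r + (r - 1)) \<and>
        y (1 + b * r) \<le> q \<and> q \<le> y (1 + b * r + (r - 1))"
    proof (intro allI impI)
      fix a b assume ab: "a < r" "b < r"
      have in_range: "2 + a * r + c \<in> {1..k}" "1 + b * r + c \<in> {1..k}" if "c < r" for c
        using two_digit_less[OF ab(1) that] two_digit_less[OF ab(2) that] k by auto
      note in_E[OF ab]
      moreover have "x (2 + a * r) \<le> x (2 + a * r + b)" "x (2 + a * r + b) \<le> x (2 + a * r + (r - 1))"
        using strict_mono_on_leD[OF x in_range(1)[of 0] in_range(1)[of b]]
          strict_mono_on_leD[OF x in_range(1)[of b] in_range(1)[of "r - 1"]] ab by auto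
      moreover have "y (1 + b * r) \<le> y (1 + b * r + a)" "y (1 + b * r + a) \<le> y (1 + b * r + (r - 1))"
        using strict_mono_on_leD[OF y in_range(2)[of 0] in_range(2)[of a]]
          strict_mono_on_leD[OF y in_range(2)[of a] in_range(2)[of "r - 1"]] ab by auto
      ultimately show "\<exists>p q. (p, q) \<in> E \<and> x (2 + a * r) \<le> p \<and> p \<le> x (2 + a * r + (r - 1)) \<and>
          y (1 + b * r) \<le> q \<and> q \<le> y (1 + b * r + (r - 1))"
        by blast
    qed
  qed
qed

section \<open>Dyadic intervals and hulls\<close>

text \<open>The pair \<open>(t, u)\<close> encodes the dyadic interval \<open>{u * 2 ^ t..<(u + 1) * 2 ^ t}\<close>.\<close>

definition dyadic_level :: "nat \<Rightarrow> nat \<Rightarrow> nat" where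
  "dyadic_level lo hi = (LEAST t. lo div 2 ^ t = hi div 2 ^ t)"

definition dyadic_hull :: "nat \<Rightarrow> nat \<Rightarrow> nat \<times> nat" where
  "dyadic_hull lo hi = (dyadic_level lo hi, lo div 2 ^ dyadic_level lo hi)"

definition ancestors :: "nat \<Rightarrow> nat \<Rightarrow> (nat \<times> nat) set" where
  "ancestors l p = (\<lambda>t. (t, p div 2 ^ t)) ` {..l}"

text \<open>A product superset of the dyadic intervals of levels 0 to \<open>l\<close> inside
  \<open>{..<2 ^ l}\<close>. It is easy to count, and the union bound absorbs the surplus.\<close>

definition dyadic_intervals :: "nat \<Rightarrow> (nat \<times> nat) set" where
  "dyadic_intervals l = {..l} \<times> {..<2 ^ l}"

lemma dyadic_level:
  assumes "lo < 2 ^ l" "hi < 2 ^ l"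
  shows "lo div 2 ^ dyadic_level lo hi = hi div 2 ^ dyadic_level lo hi" "dyadic_level lo hi \<le> l"
proof -
  have "lo div 2 ^ l = hi div 2 ^ l" using assms by simp
  then show "lo div 2 ^ dyadic_level lo hi = hi div 2 ^ dyadic_level lo hi" "dyadic_level lo hi \<le> l"
    unfolding dyadic_level_def by (rule LeastI, rule Least_le)
qed

text \<open>Monotonicity of division squeezes \<open>p\<close> into the hull. Thus an entry between
  the ends of two intervals survives only if the pair of their hulls does.\<close>

lemma dyadic_hull_in_ancestors:
  assumes "lo \<le> p" "p \<le> hi" "hi < 2 ^ l"
  shows "dyadic_hull lo hi \<in> ancestors l p"
proof -
  let ?t = "dyadic_level lo hi"
  have t: "lo div 2 ^ ?t = hi div 2 ^ ?t" "?t \<le> l" using assms by (intro dyadic_level; simp)+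
  moreover have "lo div 2 ^ ?t \<le> p div 2 ^ ?t" "p div 2 ^ ?t \<le> hi div 2 ^ ?t"
    using assms by (intro div_le_mono; simp)+
  ultimately have "dyadic_hull lo hi = (?t, p div 2 ^ ?t)" by (simp add: dyadic_hull_def)
  then show ?thesis using t(2) unfolding ancestors_def by blast
qed

text \<open>Two disjoint intervals cannot both contain the midpoint of their common dyadic hull.\<close>

lemma dyadic_hull_neq:
  assumes "lo \<le> hi" "hi < lo'" "lo' \<le> hi'"
  shows "dyadic_hull lo hi \<noteq> dyadic_hull lo' hi'"
proof
  assume eq: "dyadic_hull lo hi = dyadic_hull lo' hi'"
  obtain l :: nat where "hi' < 2 ^ l" using less_exp by blast
  define t where "t = dyadic_level lo hi"
  have t': "dyadic_level lo' hi' = t" using eq by (simp add: dyadic_hull_def t_def)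
  have same: "lo div 2 ^ t = hi div 2 ^ t" "lo' div 2 ^ t = hi' div 2 ^ t" "lo div 2 ^ t = lo' div 2 ^ t"
    using dyadic_level(1)[of lo l hi] dyadic_level(1)[of lo' l hi'] \<open>hi' < 2 ^ l\<close> assms eq t'
    by (auto simp: dyadic_hull_def t_def)
  show False
  proof (cases t)
    case 0
    then show False using same assms by simp
  next
    case (Suc s)
    \<comment> \<open>At level \<open>s = t - 1\<close> neither interval fits into one dyadic
      interval, so \<open>f lo < f hi \<le> f lo' < f hi'\<close> needs three values, while a common
      parent at level \<open>t\<close> leaves only two.\<close>
    define f where "f p = p div 2 ^ s" for p :: nat
    have half: "f p div 2 = p div 2 ^ t" for p
      by (simp only: f_def Suc power_Suc2 div_mult2_eq)
    have "f lo \<noteq> f hi" "f lo' \<noteq> f hi'"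
      using not_less_Least[of s "\<lambda>t. lo div 2 ^ t = hi div 2 ^ t"]
        not_less_Least[of s "\<lambda>t. lo' div 2 ^ t = hi' div 2 ^ t"] Suc t' t_def
      by (auto simp: f_def dyadic_level_def)
    moreover have "f lo \<le> f hi" "f hi \<le> f lo'" "f lo' \<le> f hi'"
      using assms by (auto simp: f_def intro: div_le_mono)
    ultimately show False using same half[of lo] half[of hi] half[of lo'] half[of hi'] by linarith
  qed
qed

lemma inj_on_dyadic_hull:
  assumes "separated_intervals r lo hi"
  shows "inj_on (\<lambda>a. dyadic_hull (lo a) (hi a)) {..<r}"
proof (rule linorder_inj_onI)
  fix a a' assume "a < a'" "a \<in> {..<r}" "a' \<in> {..<r}"
  then show "dyadic_hull (lo a) (hi a) \<noteq> dyadic_hull (lo a') (hi a')"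
    using assms unfolding separated_intervals_def by (intro dyadic_hull_neq) auto
qed auto

lemma ancestors_subset:
  assumes "p < 2 ^ l" shows "ancestors l p \<subseteq> dyadic_intervals l"
  unfolding ancestors_def dyadic_intervals_def
  using assms by (auto intro: le_less_trans[OF div_le_dividend])

lemma card_ancestors: "card (ancestors l p) = l + 1"
  unfolding ancestors_def by (simp add: card_image inj_on_def)

text \<open>\<open>f w = 0\<close> means that the pair \<open>w\<close> is killed. For a uniformly
  random colouring with \<open>M\<close> colours this happens independently with probability
  \<open>1 / M\<close>.\<close>

definition alive :: "nat \<Rightarrow> ((nat \<times> nat) \<times> nat \<times> nat \<Rightarrow> nat) \<Rightarrow> (nat \<times> nat) set" where
  "alive l f = {(p, q) \<in> box (2 ^ l). \<forall>w\<in>ancestors l p \<times> ancestors l q. f w \<noteq> 0}"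

text \<open>\<open>X\<close> and \<open>Y\<close> are the hulls of the position and the value
  intervals of the copy; disjointness makes them distinct. Each pair of hulls surrounds some entry
  that is alive, so it was not killed.\<close>

lemma occurs_alive_rectangle:
  assumes "r * r + 1 \<le> k" "occurs k (grid_perm r k) (alive l f)"
  obtains X Y where "X \<subseteq> dyadic_intervals l" "Y \<subseteq> dyadic_intervals l" "card X = r" "card Y = r"
    "\<forall>w\<in>X \<times> Y. f w \<noteq> 0"
proof -
  have box: "alive l f \<subseteq> box (2 ^ l)" by (auto simp: alive_def)
  obtain lo hi lo' hi' where sep: "separated_intervals r lo hi" "separated_intervals r lo' hi'"
    and bound: "\<forall>a<r. hi a < 2 ^ l \<and> hi' a < 2 ^ l"
    and E: "\<forall>a<r. \<forall>b<r. \<exists>p q. (p, q) \<in> alive l f \<and> lo a \<le> p \<and> p \<le> hi a \<and> lo' b \<le> q \<and> q \<le> hi' b"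
    by (rule occurs_grid_perm[OF assms box])
  let ?h = "\<lambda>a. dyadic_hull (lo a) (hi a)" and ?h' = "\<lambda>a. dyadic_hull (lo' a) (hi' a)"
  have hull: "?h a \<in> dyadic_intervals l" "?h' a \<in> dyadic_intervals l" if "a < r" for a
    using that bound sep ancestors_subset[of "hi a" l] ancestors_subset[of "hi' a" l]
      dyadic_hull_in_ancestors[of "lo a" "hi a" "hi a" l] dyadic_hull_in_ancestors[of "lo' a" "hi' a" "hi' a" l]
    unfolding separated_intervals_def by blast+
  have nonzero: "f (?h a, ?h' b) \<noteq> 0" if ab: "a < r" "b < r" for a b
  proof -
    obtain p q where "(p, q) \<in> alive l f" "lo a \<le> p" "p \<le> hi a" "lo' b \<le> q" "q \<le> hi' b"
      using E ab by blast
    moreover from this have "?h a \<in> ancestors l p" "?h' b \<in> ancestors l q"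
      using bound ab by (intro dyadic_hull_in_ancestors; simp)+
    ultimately show ?thesis unfolding alive_def by blast
  qed
  show thesis
  proof (rule that)
    show "card (?h ` {..<r}) = r" "card (?h' ` {..<r}) = r"
      using inj_on_dyadic_hull[OF sep(1)] inj_on_dyadic_hull[OF sep(2)] by (simp_all add: card_image)
  qed (use hull nonzero in auto)
qed

text \<open>Independence in counting form: among all \<open>M ^ card U\<close> colourings, a
  fraction \<open>(1 - 1 / M) ^ card W\<close> kills nothing in \<open>W\<close>.\<close>

lemma card_nonzero_colourings:
  fixes W U :: "'a set"
  assumes "finite U" "W \<subseteq> U" "M > 0"
  shows "real (card {f \<in> U \<rightarrow>\<^sub>E {..<M}. \<forall>w\<in>W. f w \<noteq> 0}) = (1 - 1 / real M) ^ card W * real M ^ card U"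
proof -
  let ?T = "\<lambda>u. if u \<in> W then {1..<M} else {..<M}"
  have "{f \<in> U \<rightarrow>\<^sub>E {..<M}. \<forall>w\<in>W. f w \<noteq> 0} = (\<Pi>\<^sub>E u\<in>U. ?T u)"
    using assms(2) by (fastforce simp: PiE_iff Suc_le_eq split: if_splits)
  then have "card {f \<in> U \<rightarrow>\<^sub>E {..<M}. \<forall>w\<in>W. f w \<noteq> 0} = (\<Prod>u\<in>U. if u \<in> W then M - 1 else M)"
    using assms(1) by (simp add: card_PiE if_distrib cong: if_cong)
  also have "real \<dots> = (\<Prod>u\<in>U. (if u \<in> W then 1 - 1 / real M else 1) * real M)"
    unfolding of_nat_prod using assms(3) by (intro prod.cong) (auto simp: of_nat_diff field_simps)
  also have "\<dots> = (1 - 1 / real M) ^ card W * real M ^ card U"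
    using assms(1,2) by (simp add: prod.distrib prod.If_cases Int_absorb1 flip: Int_def)
  finally show ?thesis .
qed

text \<open>First moment: if every avoiding set had fewer than \<open>c\<close> entries, the average
  size of \<open>alive l f\<close> would be at most \<open>c\<close> plus \<open>4 ^ l\<close> times
  the probability that some \<open>r\<close> by \<open>r\<close> rectangle survives. By hypothesis
  this is less than the true average \<open>4 ^ l * \<rho> ^ ((l + 1) * (l + 1))\<close>.\<close>

lemma exists_dense_avoider:
  fixes l r M k :: nat and c :: real
  defines "V \<equiv> dyadic_intervals l" and "\<rho> \<equiv> 1 - 1 / real M"
  assumes k: "r * r + 1 \<le> k" and "M > 0"
    and c: "c + 4 ^ l * (real (card V) ^ (2 * r) * \<rho> ^ (r * r)) < 4 ^ l * \<rho> ^ ((l + 1) * (l + 1))"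
  obtains E where "E \<subseteq> box (2 ^ l)" "\<not> occurs k (grid_perm r k) E" "c \<le> real (card E)"
proof (rule ccontr)
  assume "\<not> thesis"
  with that have sparse: "real (card E) < c" if "E \<subseteq> box (2 ^ l)" "\<not> occurs k (grid_perm r k) E" for E
    using that by (meson not_le)
  define F where "F = (V \<times> V) \<rightarrow>\<^sub>E {..<M}"
  \<comment> \<open>The colourings that leave some \<open>r\<close> by \<open>r\<close> rectangle of
    pairs untouched; all colourings whose \<open>alive\<close> set contains the pattern are among
    them.\<close>
  define bad where "bad = (\<Union>(X, Y)\<in>{X. X \<subseteq> V \<and> card X = r} \<times> {Y. Y \<subseteq> V \<and> card Y = r}.
    {f \<in> F. \<forall>w\<in>X \<times> Y. f w \<noteq> 0})"
  have "finite V" by (simp add: V_def dyadic_intervals_def)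
  then have fin: "finite (V \<times> V)" "finite F" by (simp_all add: F_def finite_PiE)
  define T where "T = real M ^ card (V \<times> V)"
  have "T > 0" using \<open>M > 0\<close> by (simp add: T_def)
  have cardF: "real (card F) = T" using fin by (simp add: F_def T_def card_funcsetE)
  have alive_box: "alive l f \<subseteq> box (2 ^ l)" for f by (auto simp: alive_def)
  have card_box: "card (box (2 ^ l)) = 4 ^ l"
    by (simp add: box_def card_cartesian_product flip: power_mult_distrib)
  have \<rho>: "\<rho> \<ge> 0" using \<open>M > 0\<close> by (simp add: \<rho>_def)
  have card_rect: "real (card {f \<in> F. \<forall>w\<in>W. f w \<noteq> 0}) = \<rho> ^ card W * T" if "W \<subseteq> V \<times> V" for W
    using card_nonzero_colourings[OF fin(1) that \<open>M > 0\<close>] by (simp add: F_def T_def \<rho>_def)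

  have "card bad \<le> (\<Sum>(X, Y)\<in>{X. X \<subseteq> V \<and> card X = r} \<times> {Y. Y \<subseteq> V \<and> card Y = r}.
      card {f \<in> F. \<forall>w\<in>X \<times> Y. f w \<noteq> 0})"
    unfolding bad_def case_prod_beta using \<open>finite V\<close> by (intro card_UN_le) auto
  then have "real (card bad) \<le> (\<Sum>(X, Y)\<in>{X. X \<subseteq> V \<and> card X = r} \<times> {Y. Y \<subseteq> V \<and> card Y = r}.
      real (card {f \<in> F. \<forall>w\<in>X \<times> Y. f w \<noteq> 0}))"
    unfolding case_prod_beta of_nat_sum[symmetric] by (simp only: of_nat_le_iff)
  also have "\<dots> = (\<Sum>(X, Y)\<in>{X. X \<subseteq> V \<and> card X = r} \<times> {Y. Y \<subseteq> V \<and> card Y = r}. \<rho> ^ (r * r) * T)"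
    by (intro sum.cong refl) (clarify, subst card_rect, auto simp: card_cartesian_product)
  also have "\<dots> = (real (card V choose r))\<^sup>2 * (\<rho> ^ (r * r) * T)"
    using n_subsets[OF \<open>finite V\<close>, of r]
    by (simp add: case_prod_beta card_cartesian_product power2_eq_square)
  also have "\<dots> \<le> (real (card V ^ r))\<^sup>2 * (\<rho> ^ (r * r) * T)"
  proof (intro mult_right_mono power_mono)
    have "card V choose r \<le> card V ^ r"
    proof (cases "r \<le> card V")
      case True
      then show ?thesis by (rule binomial_le_pow)
    qed (simp add: binomial_eq_0)
    then show "real (card V choose r) \<le> real (card V ^ r)" by (simp only: of_nat_le_iff)
  qed (use \<rho> \<open>T > 0\<close> in auto)
  also have "\<dots> = real (card V) ^ (2 * r) * \<rho> ^ (r * r) * T"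
    by (simp add: power_mult mult.commute)
  finally have bad: "real (card bad) \<le> real (card V) ^ (2 * r) * \<rho> ^ (r * r) * T" .

  have alive_le: "real (card (alive l f)) \<le> c + (if f \<in> bad then 4 ^ l else 0)" if "f \<in> F" for f
  proof (cases "occurs k (grid_perm r k) (alive l f)")
    case True
    obtain X Y where "X \<subseteq> V" "Y \<subseteq> V" "card X = r" "card Y = r" "\<forall>w\<in>X \<times> Y. f w \<noteq> 0"
      unfolding V_def by (rule occurs_alive_rectangle[OF k True])
    then have "f \<in> bad" using \<open>f \<in> F\<close> unfolding bad_def by blast
    have "card (alive l f) \<le> 4 ^ l"
      using card_mono[OF _ alive_box] by (simp add: card_box[symmetric] box_def)
    then have "real (card (alive l f)) \<le> 4 ^ l"
      by (metis of_nat_le_iff of_nat_numeral of_nat_power)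
    \<comment> \<open>The empty matrix avoids the pattern, which gives \<open>0 \<le> c\<close>; so
      \<open>4 ^ l\<close> alone is at most the claimed bound.\<close>
    moreover have "\<not> occurs k (grid_perm r k) {}"
      using k unfolding occurs_def by force
    then have "0 \<le> c" using sparse[of "{}"] by simp
    ultimately show ?thesis unfolding if_P[OF \<open>f \<in> bad\<close>] by linarith
  next
    case False
    show ?thesis by (intro order_trans[OF less_imp_le[OF sparse[OF alive_box False]]]) simp
  qed
  \<comment> \<open>Double counting of the pairs of an entry and a colouring that keeps it alive,
    first by entries and then by colourings.\<close>
  have "4 ^ l * \<rho> ^ ((l + 1) * (l + 1)) * T
      = (\<Sum>e\<in>box (2 ^ l). real (card {f \<in> F. e \<in> alive l f}))"
  proof -
    have "real (card {f \<in> F. e \<in> alive l f}) = \<rho> ^ ((l + 1) * (l + 1)) * T" if "e \<in> box (2 ^ l)" for e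
    proof -
      obtain p q where e: "e = (p, q)" by fastforce
      have "{f \<in> F. e \<in> alive l f} = {f \<in> F. \<forall>w\<in>ancestors l p \<times> ancestors l q. f w \<noteq> 0}"
        using that e by (auto simp: alive_def)
      moreover have "ancestors l p \<times> ancestors l q \<subseteq> V \<times> V"
        using that e unfolding V_def box_def by (intro Sigma_mono ancestors_subset) auto
      ultimately show ?thesis
        by (simp only: card_rect card_cartesian_product card_ancestors)
    qed
    then show ?thesis by (simp add: card_box)
  qed
  also have "\<dots> = (\<Sum>e\<in>box (2 ^ l). \<Sum>f\<in>F. if e \<in> alive l f then 1 else 0)"
    using fin by (simp add: sum.If_cases Int_def)
  also have "\<dots> = (\<Sum>f\<in>F. \<Sum>e\<in>box (2 ^ l). if e \<in> alive l f then 1 else 0)"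
    by (rule sum.swap)
  also have "\<dots> = (\<Sum>f\<in>F. real (card (alive l f)))"
    using alive_box by (intro sum.cong refl) (simp add: sum.If_cases Int_absorb1 box_def)
  also have "\<dots> \<le> (\<Sum>f\<in>F. c + (if f \<in> bad then 4 ^ l else 0))"
    by (intro sum_mono alive_le)
  also have "\<dots> = c * T + 4 ^ l * real (card bad)"
  proof -
    have "F \<inter> bad = bad" by (auto simp: bad_def)
    then show ?thesis using fin cardF by (simp add: sum.distrib sum.If_cases mult.commute)
  qed
  also have "\<dots> \<le> c * T + 4 ^ l * (real (card V) ^ (2 * r) * \<rho> ^ (r * r) * T)"
    using bad by simp
  also have "\<dots> = (c + 4 ^ l * (real (card V) ^ (2 * r) * \<rho> ^ (r * r))) * T"
    by (simp add: algebra_simps)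
  finally have "4 ^ l * \<rho> ^ ((l + 1) * (l + 1)) \<le> c + 4 ^ l * (real (card V) ^ (2 * r) * \<rho> ^ (r * r))"
    using \<open>T > 0\<close> by simp
  with c show False by simp
qed

text \<open>Lower bound for the survival of one entry, which has
  \<open>64 * h * h = (8 * h) ^ 2\<close> pairs of ancestors when \<open>l + 1 = 8 * h\<close>.
  Bernoulli's inequality shows that \<open>32 * h\<close> factors contribute at least 1/2, and there
  are \<open>2 * h\<close> such groups.\<close>

lemma half_le_bernoulli: "(1 / 2 :: real) ^ (2 * h) \<le> (1 - 1 / real (64 * h)) ^ (64 * h * h)"
proof (cases "h = 0")
  case False
  have "1 / 2 = 1 + real (32 * h) * (- (1 / real (64 * h)))" using False by simp
  also have "\<dots> \<le> (1 + - (1 / real (64 * h))) ^ (32 * h)"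
    using False by (intro Bernoulli_inequality) (simp add: divide_simps)
  finally have "(1 / 2 :: real) ^ (2 * h) \<le> ((1 - 1 / real (64 * h)) ^ (32 * h)) ^ (2 * h)"
    by (intro power_mono) auto
  also have "\<dots> = (1 - 1 / real (64 * h)) ^ (64 * h * h)"
    by (simp flip: power_mult add: algebra_simps)
  finally show ?thesis .
qed simp

text \<open>Follows from \<open>1 - x \<le> exp (- x)\<close> at \<open>x = 1 / M\<close> and
  \<open>exp 1 \<ge> 2\<close>. It bounds the survival of a rectangle from above.\<close>

lemma one_minus_inverse_power_le_half:
  assumes "M > 0" shows "(1 - 1 / real M) ^ M \<le> 1 / 2"
proof -
  have "(1 - 1 / real M) ^ M \<le> exp (- (1 / real M)) ^ M"
    using assms exp_ge_add_one_self[of "- (1 / real M)"] by (intro power_mono) auto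
  also have "\<dots> = exp (- 1)" using assms by (simp flip: exp_of_nat_mult)
  also have "\<dots> \<le> 1 / 2" using exp_ge_add_one_self[of 1] by (simp add: exp_minus field_simps)
  finally show ?thesis .
qed

lemma card_dyadic_intervals: "card (dyadic_intervals l) = (l + 1) * 2 ^ l"
  by (simp add: dyadic_intervals_def card_cartesian_product)

text \<open>Here \<open>l + 1 = 8 * h\<close> and \<open>M = 64 * h\<close>, so that an entry survives with probability at least
  \<open>4 ^ (- h)\<close>; the choice \<open>r = 33 * h * M\<close> makes a surviving rectangle less likely than that
  even after the union bound over at most \<open>(2 ^ (16 * h)) ^ (2 * r)\<close> rectangles.\<close>

lemma exists_dense_grid_avoider:
  fixes h k :: nat
  defines "r \<equiv> 2112 * h\<^sup>2"
  assumes "h > 0" and k: "r * r + 1 \<le> k"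
  obtains E where "E \<subseteq> box (2 ^ (8 * h - 1))" "\<not> occurs k (grid_perm r k) E" "2 ^ (14 * h - 3) \<le> card E"
proof -
  define l where "l = 8 * h - 1"
  define M where "M = 64 * h"
  define \<rho> where "\<rho> = 1 - 1 / real M"
  define v where "v = card (dyadic_intervals l)"
  have M: "M > 0" and l: "l + 1 = 8 * h" "2 * l = 16 * h - 2" using \<open>h > 0\<close> by (simp_all add: M_def l_def)
  have \<rho>: "\<rho> \<ge> 0" using M by (simp add: \<rho>_def)
  have "v \<le> 2 ^ (16 * h)"
  proof -
    have "v = 8 * h * 2 ^ l" by (simp only: v_def card_dyadic_intervals l(1))
    also have "\<dots> \<le> 2 ^ (8 * h) * 2 ^ (8 * h)"
      by (intro mult_mono less_imp_le[OF less_exp] power_increasing) (auto simp: l_def)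
    finally show ?thesis by (simp flip: power_add)
  qed
  then have v: "real v \<le> 2 ^ (16 * h)" by (metis of_nat_le_iff of_nat_numeral of_nat_power)
  have "real v ^ (2 * r) * \<rho> ^ (r * r) \<le> (2 ^ (16 * h)) ^ (2 * r) * (1 / 2) ^ (33 * h * r)"
  proof (intro mult_mono power_mono v)
    have "\<rho> ^ (r * r) = (\<rho> ^ M) ^ (33 * h * r)"
      by (simp add: r_def M_def power2_eq_square algebra_simps flip: power_mult)
    also have "\<dots> \<le> (1 / 2) ^ (33 * h * r)"
      using \<rho> one_minus_inverse_power_le_half[OF M] by (intro power_mono) (auto simp: \<rho>_def)
    finally show "\<rho> ^ (r * r) \<le> (1 / 2) ^ (33 * h * r)" .
  qed (use \<rho> in auto)
  \<comment> \<open>The 33 in \<open>r = 33 * h * M\<close> exceeds by one the \<open>16 * 2\<close>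
    spent on the union bound, which leaves \<open>(1 / 2) ^ (h * r)\<close>.\<close>
  also have "\<dots> = (1 / 2) ^ (h * r)"
  proof -
    have "(2::real) ^ a * (1 / 2) ^ (a + c) = (1 / 2) ^ c" for a c
      by (simp add: power_add power_one_over)
    moreover have "33 * h * r = 16 * h * (2 * r) + h * r" by simp
    ultimately show ?thesis by (simp only: power_mult[symmetric])
  qed
  also have "\<dots> < (1 / 2) ^ (2 * h + 1)"
  proof (rule power_strict_decreasing)
    have "2112 \<le> r" using \<open>h > 0\<close> by (simp add: r_def)
    then have "h * 2112 \<le> h * r" by simp
    then show "2 * h + 1 < h * r" using \<open>h > 0\<close> by linarith
  qed auto
  finally have small: "real v ^ (2 * r) * \<rho> ^ (r * r) < (1 / 2) ^ (2 * h + 1)" .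
  have large: "(1 / 2) ^ (2 * h) \<le> \<rho> ^ ((l + 1) * (l + 1))"
    using half_le_bernoulli[of h] unfolding l(1) \<rho>_def M_def by (simp add: algebra_simps)
  \<comment> \<open>\<open>c\<close> is taken to be half of the guaranteed average number
    \<open>4 ^ l * (1 / 2) ^ (2 * h)\<close> of survivors; the other half outweighs the bad
    colourings.\<close>
  have "(4::real) ^ l * (1 / 2) ^ (2 * h + 1) + 4 ^ l * (real v ^ (2 * r) * \<rho> ^ (r * r))
      = 4 ^ l * ((1 / 2) ^ (2 * h + 1) + real v ^ (2 * r) * \<rho> ^ (r * r))"
    by (simp add: algebra_simps)
  also have "\<dots> < 4 ^ l * ((1 / 2) ^ (2 * h + 1) + (1 / 2) ^ (2 * h + 1))"
    using small by (intro mult_strict_left_mono add_strict_left_mono) auto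
  also have "\<dots> = 4 ^ l * (1 / 2) ^ (2 * h)" by simp
  also have "\<dots> \<le> 4 ^ l * \<rho> ^ ((l + 1) * (l + 1))" using large by simp
  finally obtain E where E: "E \<subseteq> box (2 ^ l)" "\<not> occurs k (grid_perm r k) E"
    "(4::real) ^ l * (1 / 2) ^ (2 * h + 1) \<le> real (card E)"
    using exists_dense_avoider[OF k M, of "4 ^ l * (1 / 2) ^ (2 * h + 1)" l] unfolding v_def \<rho>_def by blast
  have "(4::real) ^ l * (1 / 2) ^ (2 * h + 1) = 2 ^ (14 * h - 3)"
  proof -
    have "14 * h - 3 + (2 * h + 1) = 2 * l" using l \<open>h > 0\<close> by linarith
    then have "(2::real) ^ (14 * h - 3) * 2 ^ (2 * h + 1) = (2 ^ 2) ^ l"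
      by (metis power_add power_mult)
    then show ?thesis by (simp add: power_one_over field_simps)
  qed
  then have "real (2 ^ (14 * h - 3)) \<le> real (card E)" using E(3) by simp
  then have "2 ^ (14 * h - 3) \<le> card E" by (simp only: of_nat_le_iff)
  with E that show thesis unfolding l_def by blast
qed

section \<open>Counting matchings\<close>

definition matching_lists :: "(nat \<times> nat) set \<Rightarrow> nat \<Rightarrow> (nat \<times> nat) list set" where
  "matching_lists E m = {zs. length zs = m \<and> set zs \<subseteq> E \<and> distinct (map fst zs) \<and> distinct (map snd zs)}"

lemma finite_matching_lists: "finite E \<Longrightarrow> finite (matching_lists E m)"
  by (rule finite_subset[OF _ finite_lists_length_eq[of E m]]) (auto simp: matching_lists_def)

text \<open>Greedy choice: each chosen entry excludes only its row and its column, at most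
  \<open>2 * n\<close> entries, so at least \<open>B\<close> candidates remain at each of the
  \<open>m\<close> steps.\<close>

lemma card_matching_lists_ge:
  assumes E: "E \<subseteq> box n" and "B + 2 * n * m \<le> card E"
  shows "B ^ m \<le> card (matching_lists E m)"
  using assms(2)
proof (induction m)
  case 0
  have "matching_lists E 0 = {[]}" by (auto simp: matching_lists_def)
  then show ?case by simp
next
  case (Suc m)
  have finE: "finite E" by (rule finite_subset_box[OF E])
  let ?free = "\<lambda>zs. {e \<in> E. fst e \<notin> fst ` set zs \<and> snd e \<notin> snd ` set zs}"
  have free: "B \<le> card (?free zs)" if "zs \<in> matching_lists E m" for zs
  proof -
    have len: "card (set zs) \<le> m"
      using that card_length[of zs] by (simp add: matching_lists_def)
    have "E \<subseteq> ?free zs \<union> (fst ` set zs \<times> {..<n} \<union> {..<n} \<times> snd ` set zs)"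
    proof
      fix e assume "e \<in> E"
      moreover have "fst e < n" "snd e < n" using \<open>e \<in> E\<close> E by (auto simp: box_def)
      ultimately show "e \<in> ?free zs \<union> (fst ` set zs \<times> {..<n} \<union> {..<n} \<times> snd ` set zs)"
        by (simp add: mem_Times_iff) blast
    qed
    then have "card E \<le> card (?free zs \<union> (fst ` set zs \<times> {..<n} \<union> {..<n} \<times> snd ` set zs))"
      using finE by (intro card_mono) auto
    also have "\<dots> \<le> card (?free zs) + (card (fst ` set zs \<times> {..<n}) + card ({..<n} \<times> snd ` set zs))"
      by (intro order_trans[OF card_Un_le] add_left_mono card_Un_le)
    also have "\<dots> \<le> card (?free zs) + (m * n + n * m)"
      unfolding card_cartesian_product using len card_image_le[of "set zs" fst] card_image_le[of "set zs" snd]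
      by (intro add_mono mult_mono) (auto intro: order_trans)
    finally show ?thesis using Suc.prems by (simp add: algebra_simps)
  qed
  have "B ^ Suc m \<le> card (matching_lists E m) * B" using Suc by simp
  also have "\<dots> = (\<Sum>zs\<in>matching_lists E m. B)" by simp
  also have "\<dots> \<le> (\<Sum>zs\<in>matching_lists E m. card (?free zs))" by (intro sum_mono free)
  also have "\<dots> = card (Sigma (matching_lists E m) ?free)"
    using finE finite_matching_lists[OF finE] by (simp add: card_SigmaI)
  also have "\<dots> \<le> card (matching_lists E (Suc m))"
  proof (rule card_inj_on_le)
    show "inj_on (\<lambda>(zs, e). e # zs) (Sigma (matching_lists E m) ?free)" by (auto simp: inj_on_def)
    show "(\<lambda>(zs, e). e # zs) ` Sigma (matching_lists E m) ?free \<subseteq> matching_lists E (Suc m)"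
      by (auto simp: matching_lists_def)
    show "finite (matching_lists E (Suc m))" by (rule finite_matching_lists[OF finE])
  qed
  finally show ?case .
qed

text \<open>A canonical choice, depending on the set alone, makes \<open>matching_of\<close> a
  function of its arguments, as the upper count of matchings requires.\<close>

definition increasing_enum :: "nat set \<Rightarrow> nat \<Rightarrow> nat" where
  "increasing_enum S = (SOME e. strict_mono_on {1..card S} e \<and> bij_betw e {1..card S} S)"

lemma increasing_enum:
  assumes "finite S"
  shows "strict_mono_on {1..card S} (increasing_enum S)" "bij_betw (increasing_enum S) {1..card S} S"
proof -
  have "\<exists>e. strict_mono_on {1..card S} e \<and> bij_betw e {1..card S} S"
    using increasing_enumeration[OF assms] by blast
  from someI_ex[OF this] show "strict_mono_on {1..card S} (increasing_enum S)"
      "bij_betw (increasing_enum S) {1..card S} S"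
    unfolding increasing_enum_def by blast+
qed

text \<open>Rebuilds an ordered matching from the list of its first coordinates, the set of its
  second coordinates and its pattern: the first coordinate of rank \<open>i\<close> is paired with
  the element of \<open>Q\<close> of rank \<open>\<sigma> i\<close>.\<close>

definition matching_of :: "nat list \<Rightarrow> nat set \<Rightarrow> (nat \<Rightarrow> nat) \<Rightarrow> (nat \<times> nat) list" where
  "matching_of ps Q \<sigma> =
    map (\<lambda>p. (p, increasing_enum Q (\<sigma> (inv_into {1..length ps} (increasing_enum (set ps)) p)))) ps"

text \<open>\<sigma> is the standardization of the matching, sending the rank of a first coordinate
  to the rank of its partner. The increasing enumerations \<open>e\<close> and \<open>d\<close>
  would carry a copy of \<pi> in \<sigma> to a copy in \<open>E\<close>.\<close>

lemma matching_listE: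
  assumes \<pi>: "\<pi> permutes {1..k}" and avoid: "\<not> occurs k \<pi> E" and "zs \<in> matching_lists E m"
  obtains \<sigma> where "\<sigma> \<in> avoiders m k \<pi>" "zs = matching_of (map fst zs) (set (map snd zs)) \<sigma>"
proof -
  define P Q where "P = fst ` set zs" and "Q = snd ` set zs"
  have len: "length zs = m" and zs: "set zs \<subseteq> E" and dist: "distinct (map fst zs)" "distinct (map snd zs)"
    using assms(3) by (auto simp: matching_lists_def)
  have P: "finite P" "card P = m" and Q: "finite Q" "card Q = m"
    using dist len distinct_card[OF dist(1)] distinct_card[OF dist(2)] by (simp_all add: P_def Q_def)
  define e d where "e = increasing_enum P" and "d = increasing_enum Q"
  have e: "strict_mono_on {1..m} e" "bij_betw e {1..m} P"
    and d: "strict_mono_on {1..m} d" "bij_betw d {1..m} Q"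
    using increasing_enum[OF P(1)] increasing_enum[OF Q(1)] P Q by (simp_all add: e_def d_def)
  have inj: "inj_on fst (set zs)" "inj_on snd (set zs)"
    using dist by (simp_all add: distinct_map)
  have fst_bij: "bij_betw fst (set zs) P" and snd_bij: "bij_betw snd (set zs) Q"
    using inj by (simp_all add: bij_betw_def P_def Q_def)
  \<comment> \<open>From rank to first coordinate, to entry, to second coordinate, and back to
    rank.\<close>
  define g where "g = inv_into {1..m} d \<circ> (snd \<circ> (inv_into (set zs) fst \<circ> e))"
  have g: "bij_betw g {1..m} {1..m}"
    unfolding g_def
    by (rule bij_betw_trans[OF bij_betw_trans[OF bij_betw_trans[OF e(2) bij_betw_inv_into[OF fst_bij]] snd_bij] bij_betw_inv_into[OF d(2)]])
  define \<sigma> where "\<sigma> i = (if i \<in> {1..m} then g i else i)" for i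
  have "bij_betw \<sigma> {1..m} {1..m}" using g by (subst bij_betw_cong[of _ \<sigma> g]) (auto simp: \<sigma>_def)
  then have \<sigma>: "\<sigma> permutes {1..m}" by (rule bij_imp_permutes) (auto simp: \<sigma>_def)
  have partner: "d (\<sigma> (inv_into {1..m} e (fst z))) = snd z" if z: "z \<in> set zs" for z
  proof -
    have "fst z \<in> P" using z by (simp add: P_def)
    then have i: "inv_into {1..m} e (fst z) \<in> {1..m}" "e (inv_into {1..m} e (fst z)) = fst z"
      using e(2) by (metis bij_betw_imp_surj_on inv_into_into, metis bij_betw_inv_into_right)
    have "inv_into (set zs) fst (fst z) = z" using inj(1) z by simp
    moreover have "snd z \<in> Q" using z by (simp add: Q_def)
    ultimately show ?thesis
      using i bij_betw_inv_into_right[OF d(2)] by (simp only: \<sigma>_def g_def o_apply if_True)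
  qed
  have pair: "(e i, d (\<sigma> i)) \<in> E" if i: "i \<in> {1..m}" for i
  proof -
    have "e i \<in> P" using e(2) i by (simp add: bij_betwE)
    then obtain z where z: "z \<in> set zs" "fst z = e i" by (auto simp: P_def)
    then have "d (\<sigma> i) = snd z"
      using partner[OF z(1)] bij_betw_inv_into_left[OF e(2) i] by simp
    then have "(e i, d (\<sigma> i)) = z" using z(2) by (simp add: prod_eq_iff)
    then show ?thesis using z(1) zs by blast
  qed
  have "\<not> contains_pattern m \<sigma> k \<pi>"
  proof
    assume "contains_pattern m \<sigma> k \<pi>"
    then obtain x where x: "strict_mono_on {1..k} x" "x ` {1..k} \<subseteq> {1..m}"
      and iff: "\<forall>i\<in>{1..k}. \<forall>j\<in>{1..k}. \<sigma> (x i) < \<sigma> (x j) \<longleftrightarrow> \<pi> i < \<pi> j"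
      unfolding contains_pattern_def by (elim exE conjE) (rule that)
    have xm: "x i \<in> {1..m}" and \<sigma>xm: "\<sigma> (x i) \<in> {1..m}" if "i \<in> {1..k}" for i
      using x(2) that permutes_in_image[OF \<sigma>, of "x i"] by blast+
    have "occurs k \<pi> E"
    proof (rule occursI[OF \<pi>])
      fix i j assume ij: "i \<in> {1..k}" "j \<in> {1..k}"
      show "e (x i) < e (x j)" if "i < j"
        by (rule strict_mono_onD[OF e(1) xm[OF ij(1)] xm[OF ij(2)] strict_mono_onD[OF x(1) ij that]])
      show "d (\<sigma> (x i)) < d (\<sigma> (x j))" if "\<pi> i < \<pi> j"
        by (rule strict_mono_onD[OF d(1) \<sigma>xm[OF ij(1)] \<sigma>xm[OF ij(2)]]) (use iff ij that in blast)
    qed (use pair xm in blast)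
    with avoid show False by blast
  qed
  then have "\<sigma> \<in> avoiders m k \<pi>" using \<sigma> by (simp add: avoiders_def)
  moreover have "map (\<lambda>z. (fst z, d (\<sigma> (inv_into {1..m} e (fst z))))) zs = zs"
    by (rule map_idI) (simp only: partner prod.collapse)
  then have "zs = matching_of (map fst zs) (set (map snd zs)) \<sigma>"
    by (simp add: matching_of_def len P_def Q_def e_def d_def comp_def)
  ultimately show thesis by (rule that)
qed

text \<open>Every matching is rebuilt by \<open>matching_of\<close> from a triple; the three factors
  count the lists of first coordinates, the sets of second coordinates and the patterns.\<close>

lemma card_matching_lists_le:
  assumes \<pi>: "\<pi> permutes {1..k}" and avoid: "\<not> occurs k \<pi> E" and E: "E \<subseteq> box n"
  shows "card (matching_lists E m) \<le> n ^ m * ((n choose m) * num_avoiders m k \<pi>)"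
proof -
  let ?L = "{ps. set ps \<subseteq> {..<n} \<and> length ps = m}" and ?Q = "{Q. Q \<subseteq> {..<n} \<and> card Q = m}"
  let ?D = "?L \<times> ?Q \<times> avoiders m k \<pi>"
  let ?f = "\<lambda>(ps, Q, \<sigma>). matching_of ps Q \<sigma>"
  have "matching_lists E m \<subseteq> ?f ` ?D"
  proof
    fix zs assume zs: "zs \<in> matching_lists E m"
    obtain \<sigma> where \<sigma>: "\<sigma> \<in> avoiders m k \<pi>" "zs = matching_of (map fst zs) (set (map snd zs)) \<sigma>"
      by (rule matching_listE[OF \<pi> avoid zs])
    have "map fst zs \<in> ?L" using zs E by (auto simp: matching_lists_def box_def)
    moreover have "set (map snd zs) \<in> ?Q"
      using zs E distinct_card[of "map snd zs"] by (auto simp: matching_lists_def box_def)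
    ultimately show "zs \<in> ?f ` ?D" using \<sigma> by (intro image_eqI[of _ _ "(map fst zs, set (map snd zs), \<sigma>)"]) auto
  qed
  moreover have fin: "finite ?D"
    using finite_avoiders finite_lists_length_eq[of "{..<n}" m] by (intro finite_cartesian_product) auto
  ultimately have "card (matching_lists E m) \<le> card ?D"
    by (meson card_image_le card_mono finite_imageI order_trans)
  also have "\<dots> = n ^ m * ((n choose m) * num_avoiders m k \<pi>)"
    using card_lists_length_eq[of "{..<n}" m] n_subsets[of "{..<n}" m]
    by (simp add: card_cartesian_product num_avoiders_def)
  finally show ?thesis .
qed

text \<open>\<open>m ^ m / m!\<close> is a single term of the exponential series at
  \<open>m\<close>, all of whose terms are nonnegative.\<close>

lemma power_le_fact_exp: "real m ^ m \<le> fact m * exp (real m)"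
proof -
  have "real m ^ m / fact m \<le> exp (real m)"
    using summable_exp_generic[of "real m"] sum_le_suminf[of "\<lambda>n. real m ^ n /\<^sub>R fact n" "{m}"]
    by (simp add: exp_def divide_inverse mult.commute)
  then show ?thesis by (simp add: divide_simps mult.commute)
qed

text \<open>With \<open>n = 2 ^ (8 * h - 1)\<close>, the greedy count gives \<open>B ^ m\<close> ordered matchings for
  \<open>B = 2 ^ (14 * h - 4)\<close>, and \<open>m ^ m \<le> m! * 4 ^ m\<close> reduces the claim to \<open>B * m = 4 * n\<^sup>2 * 2 ^ (4 * h - 8)\<close>.\<close>

lemma num_avoiders_grid_perm_ge:
  fixes h k :: nat
  defines "r \<equiv> 2112 * h\<^sup>2" and "m \<equiv> 2 ^ (6 * h - 4)"
  assumes "h \<ge> 2" and k: "r * r + 1 \<le> k"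
  shows "(2 ^ (4 * h - 8)) ^ m \<le> real (num_avoiders m k (grid_perm r k))"
proof -
  let ?S = "real (num_avoiders m k (grid_perm r k))"
  define n :: nat where "n = 2 ^ (8 * h - 1)"
  define B :: nat where "B = 2 ^ (14 * h - 4)"
  have "h > 0" using \<open>h \<ge> 2\<close> by simp
  obtain E where E: "E \<subseteq> box n" "\<not> occurs k (grid_perm r k) E" "2 ^ (14 * h - 3) \<le> card E"
    unfolding n_def r_def by (rule exists_dense_grid_avoider[OF \<open>h > 0\<close> k[unfolded r_def]])
  \<comment> \<open>\<open>m\<close> is chosen so that \<open>2 * n * m = B\<close>: half of the
    \<open>2 ^ (14 * h - 3)\<close> entries may be excluded by earlier choices while
    \<open>B\<close> stay available.\<close>
  have "2 * n * m = 2 ^ (1 + (8 * h - 1) + (6 * h - 4))"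
    unfolding n_def m_def power_add by simp
  also have "1 + (8 * h - 1) + (6 * h - 4) = 14 * h - 4" using \<open>h \<ge> 2\<close> by linarith
  finally have "B + 2 * n * m = 2 ^ Suc (14 * h - 4)" by (simp add: B_def)
  also have "Suc (14 * h - 4) = 14 * h - 3" using \<open>h \<ge> 2\<close> by linarith
  finally have le: "B + 2 * n * m = 2 ^ (14 * h - 3)" .
  have "B ^ m \<le> card (matching_lists E m)"
    using E(3) le by (intro card_matching_lists_ge[OF E(1)]) simp
  also have "\<dots> \<le> n ^ m * ((n choose m) * num_avoiders m k (grid_perm r k))"
    by (rule card_matching_lists_le[OF grid_perm_permutes[OF k] E(2,1)])
  \<comment> \<open>The factor \<open>m!\<close> turns the binomial coefficient into at most
    \<open>n ^ m\<close>, and later meets \<open>m ^ m \<le> m! * 4 ^ m\<close>.\<close>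
  finally have "B ^ m * fact m \<le> n ^ m * ((n choose m) * num_avoiders m k (grid_perm r k)) * fact m"
    by (rule mult_right_mono) simp
  also have "\<dots> = n ^ m * ((n choose m) * fact m) * num_avoiders m k (grid_perm r k)" by simp
  also have "\<dots> \<le> n ^ m * n ^ m * num_avoiders m k (grid_perm r k)"
    by (intro mult_right_mono mult_left_mono binomial_fact_pow) auto
  finally have "real (B ^ m * fact m) \<le> real (n ^ m * n ^ m * num_avoiders m k (grid_perm r k))"
    by (simp only: of_nat_le_iff)
  then have count: "real B ^ m * fact m \<le> real n ^ m * real n ^ m * ?S" by simp
  have "exp (real m) = exp 1 ^ m" by (simp flip: exp_of_nat_mult)
  also have "\<dots> \<le> 4 ^ m" using exp_le by (intro power_mono) auto
  finally have "real m ^ m \<le> fact m * 4 ^ m"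
    using power_le_fact_exp[of m] by (meson fact_ge_zero mult_left_mono order_trans)
  then have "real B ^ m * real m ^ m \<le> real B ^ m * (fact m * 4 ^ m)"
    by (intro mult_left_mono) auto
  also have "\<dots> = real B ^ m * fact m * 4 ^ m" by simp
  also have "\<dots> \<le> real n ^ m * real n ^ m * ?S * 4 ^ m"
    using count by (rule mult_right_mono) simp
  also have "\<dots> = (4 * real n ^ 2) ^ m * ?S"
    by (simp add: power_mult_distrib power2_eq_square)
  finally have "(real B * real m) ^ m \<le> (4 * real n ^ 2) ^ m * ?S"
    by (simp only: power_mult_distrib)
  moreover have "real B * real m = 4 * real n ^ 2 * 2 ^ (4 * h - 8)"
  proof -
    \<comment> \<open>\<open>h \<ge> 2\<close> keeps all natural subtractions exact, down to
      \<open>4 * h - 8\<close>.\<close>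
    have "14 * h - 4 + (6 * h - 4) = 2 + (8 * h - 1) * 2 + (4 * h - 8)"
      using \<open>h \<ge> 2\<close> by linarith
    then have "(2::real) ^ (14 * h - 4) * 2 ^ (6 * h - 4) = 2 ^ 2 * (2 ^ (8 * h - 1)) ^ 2 * 2 ^ (4 * h - 8)"
      by (simp only: power_add[symmetric] power_mult[symmetric])
    then show ?thesis by (simp add: B_def m_def n_def)
  qed
  ultimately have "(4 * real n ^ 2) ^ m * (2 ^ (4 * h - 8)) ^ m \<le> (4 * real n ^ 2) ^ m * ?S"
    by (simp only: power_mult_distrib)
  moreover have "(4 * real n ^ 2) ^ m > 0" by (simp add: n_def)
  ultimately show ?thesis by (simp only: mult_le_cancel_left_pos)
qed

lemma stanley_wilf_limit_grid_perm_ge: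
  fixes h k :: nat
  defines "r \<equiv> 2112 * h\<^sup>2"
  assumes "h \<ge> 2" and k: "r * r + 1 \<le> k"
  shows "2 ^ (4 * h - 8) \<le> stanley_wilf_limit k (grid_perm r k)"
proof -
  have "r > 0" using \<open>h \<ge> 2\<close> by (simp add: r_def)
  then have "r * r > 0" by simp
  then have "k \<ge> 2" using k by linarith
  obtain K where "\<forall>n. real (num_avoiders n k (grid_perm r k)) \<le> K ^ n"
    using num_avoiders_exponential[OF grid_perm_permutes[OF k] \<open>k \<ge> 2\<close>] ..
  then show ?thesis
    using num_avoiders_grid_perm_ge[OF \<open>h \<ge> 2\<close> k[unfolded r_def]] \<open>k \<ge> 2\<close> unfolding r_def
    by (intro stanley_wilf_limit_ge[OF grid_perm_permutes[OF k[unfolded r_def]] grid_perm_1,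
        where m = "2 ^ (6 * h - 4)" and K = K]) simp_all
qed

section \<open>Interpolation to all lengths\<close>

definition threshold :: "nat \<Rightarrow> nat" where
  "threshold h = (2112 * h\<^sup>2) * (2112 * h\<^sup>2) + 1"

theorem theorem1:
  "\<exists>c::real. c > 0 \<and> (\<exists>k0::nat. k0 > 0 \<and>
     (\<forall>k::nat. k \<ge> k0 \<longrightarrow>
       (\<exists>\<pi>::nat \<Rightarrow> nat. \<pi> permutes {1..k} \<and>
          stanley_wilf_limit k \<pi> \<ge> 2 powr (c * real k powr (1/4)))))"
proof (rule exI[of _ "1/100"], intro conjI exI[of _ "threshold 3"] allI impI)
  show "(0::real) < 1 / 100" "0 < threshold 3" by (simp_all add: threshold_def)
  fix k assume "threshold 3 \<le> k"
  have mono: "threshold a \<le> threshold b" if "a \<le> b" for a b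
    unfolding threshold_def using that by (intro add_right_mono mult_le_mono power_mono) auto
  \<comment> \<open>\<open>threshold h\<close> is the least length that accommodates the grid for
    parameter \<open>h\<close>. Hence \<open>H - 1\<close> is the largest parameter that fits into
    length \<open>k\<close>.\<close>
  define H where "H = (LEAST H. k < threshold H)"
  have "k \<le> k * k * (k * k)" by (cases k) auto
  moreover have "threshold k = 4460544 * (k * k * (k * k)) + 1" by (simp add: threshold_def power2_eq_square)
  ultimately have "k < threshold k" by linarith
  then have "k < threshold H" unfolding H_def by (rule LeastI)
  have "3 < H" using \<open>k < threshold H\<close> \<open>threshold 3 \<le> k\<close> mono[of H 3] by (meson not_le order_trans)
  define h where "h = H - 1"
  have "h \<ge> 3" "H = h + 1" using \<open>3 < H\<close> by (simp_all add: h_def)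
  have "threshold h \<le> k" using not_less_Least[of h "\<lambda>H. k < threshold H"] \<open>H = h + 1\<close> by (simp add: H_def)
  define r where "r = 2112 * h\<^sup>2"
  have r: "r * r + 1 \<le> k" using \<open>threshold h \<le> k\<close> by (simp add: threshold_def r_def)

  \<comment> \<open>Maximality of \<open>h\<close> and \<open>h + 1 \<le> 2 * h\<close> give
    \<open>k \<le> (2112 * 4) ^ 2 * h ^ 4 \<le> (100 * h) ^ 4\<close>, the source of the constant
    1/100; \<open>h \<ge> 3\<close> then yields \<open>h \<le> 4 * h - 8\<close>.\<close>
  have "k \<le> (2112 * (h + 1)\<^sup>2) * (2112 * (h + 1)\<^sup>2)"
    using \<open>k < threshold H\<close> \<open>H = h + 1\<close> by (simp add: threshold_def)
  also have "\<dots> \<le> (2112 * (2 * h)\<^sup>2) * (2112 * (2 * h)\<^sup>2)"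
    using \<open>h \<ge> 3\<close> by (intro mult_le_mono power_mono) auto
  also have "\<dots> \<le> (100 * h) ^ 4"
    by (simp add: power2_eq_square power4_eq_xxxx)
  finally have "real k \<le> real ((100 * h) ^ 4)" by (simp only: of_nat_le_iff)
  then have "real k powr (1/4) \<le> (real (100 * h) ^ 4) powr (1/4)"
    by (intro powr_mono2) auto
  also have "\<dots> = (real (100 * h) powr 4) powr (1/4)"
    by (subst powr_numeral) simp_all
  also have "\<dots> = 100 * real h" by (simp only: powr_powr) simp
  finally have "1/100 * real k powr (1/4) \<le> real (4 * h - 8)" using \<open>h \<ge> 3\<close> by simp
  then have "2 powr (1/100 * real k powr (1/4)) \<le> 2 powr real (4 * h - 8)"
    by (intro powr_mono) auto
  also have "\<dots> = 2 ^ (4 * h - 8)" by (simp add: powr_realpow)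
  also have "\<dots> \<le> stanley_wilf_limit k (grid_perm r k)"
    unfolding r_def using \<open>h \<ge> 3\<close> r[unfolded r_def] by (intro stanley_wilf_limit_grid_perm_ge) auto
  finally have "2 powr (1/100 * real k powr (1/4)) \<le> stanley_wilf_limit k (grid_perm r k)" .
  with grid_perm_permutes[OF r]
  show "\<exists>\<pi>. \<pi> permutes {1..k} \<and> 2 powr (1/100 * real k powr (1/4)) \<le> stanley_wilf_limit k \<pi>"
    by blast
qed

end
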